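(* Let $\mathcal X$ and $\mathcal Y$ be two bounded subsets of $\mathbb R^d$, let $\alpha$ and $\beta$ be probability measures on $\mathcal X$ and $\mathcal Y$ respectively, and let $c$ be a $C^\infty$, $L$-Lipschitz cost. Then $$\mathbb E\,\big|W_\varepsilon(\alpha,\beta)-W_\varepsilon(\hat\alpha_n,\hat\beta_n)\big|=O\left(\frac{e^{\kappa/\varepsilon}}{\sqrt n}\left(1+\frac1{\varepsilon^{\lfloor d/2\rfloor}}\right)\right),$$ where $\kappa=2L|\mathcal X|+\|c\|_\infty$ and the constants only depend on $|\mathcal X|$, $|\mathcal Y|$, $d$, and $\|c^{(k)}\|_\infty$ for $k=0,\dots,\lfloor d/2\rfloor$. In particular, $$\mathbb E\,\big|W_\varepsilon(\alpha,\beta)-W_\varepsilon(\hat\alpha_n,\hat\beta_n)\big|=O\left(\frac{e^{\kappa/\varepsilon}}{\varepsilon^{\lfloor d/2\rfloor}\sqrt n}\right)\ \text{ as }\varepsilon\to0,$$ $$\mathbb E\,\big|W_\varepsilon(\alpha,\beta)-W_\varepsilon(\hat\alpha_n,\hat\beta_n)\big|=O\left(\frac1{\sqrt n}\right)\ \text{ as }\varepsilon\to+\infty.$$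
   Context: $|\mathcal X|=\sup\{\|x-x'\|:x,x'\in\mathcal X\}$ is the diameter of $\mathcal X$ (similarly for $\mathcal Y$). $\|c\|_\infty$ is the sup norm of the cost $c$ on $\mathcal X\times\mathcal Y$, and $\|c^{(k)}\|_\infty$ the sup norm of its derivatives of order $k$. For $\varepsilon>0$ the entropy-regularized optimal transport cost is $$W_\varepsilon(\alpha,\beta)=\min_{\pi\in\Pi(\alpha,\beta)}\int_{\mathcal X\times\mathcal Y} c(x,y)\,d\pi(x,y)+\varepsilon\int_{\mathcal X\times\mathcal Y}\log\left(\frac{d\pi(x,y)}{d\alpha(x)d\beta(y)}\right)d\pi(x,y),$$ where $\Pi(\alpha,\beta)$ is the set of probability measures on $\mathcal X\times\mathcal Y$ with marginals $\alpha$ and $\beta$ (the entropy term is $+\infty$ if $\pi$ is not absolutely continuous with respect to $\alpha\otimes\beta$). The empirical measures are $\hat\alpha_n=\frac1n\sum_{i=1}^n\delta_{X_i}$ and $\hat\beta_n=\frac1n\sum_{i=1}^n\delta_{Y_i}$, where $(X_i,Y_i)_{i=1}^n$ are i.i.d. random variables distributed according to $\alpha\otimes\beta$; the expectation is over these samples. *)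

theory Defs
  imports "HOL-Probability.Probability"
begin

(* A probability measure on an arbitrary, possibly non-Borel, subset X carries the trace of the
   Borel sigma-algebra; in particular space \<mu> = X. *)
definition prob_measure_on :: "'a::topological_space set \<Rightarrow> 'a measure \<Rightarrow> bool" where
  "prob_measure_on X \<mu> \<longleftrightarrow> prob_space \<mu> \<and> sets \<mu> = sets (restrict_space borel X)"

definition couplings :: "'a measure \<Rightarrow> 'b measure \<Rightarrow> ('a \<times> 'b) measure set" where
  "couplings \<alpha> \<beta> =
     {\<pi>. prob_space \<pi> \<and> sets \<pi> = sets (\<alpha> \<Otimes>\<^sub>M \<beta>) \<and> distr \<pi> \<alpha> fst = \<alpha> \<and> distr \<pi> \<beta> snd = \<beta>}"

(* KL_divergence (exp 1) \<mu> \<pi> is the integral of ln (d\<pi>/d\<mu>) with respect to \<pi>, but as a Bochner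
   integral it is 0 when the integrand is not integrable. For probability measures the negative
   part of ln (d\<pi>/d\<mu>) is always \<pi>-integrable, so non-integrability means that the integral
   is +\<infinity>. *)
definition relative_entropy :: "'a measure \<Rightarrow> 'a measure \<Rightarrow> ereal" where
  "relative_entropy \<pi> \<mu> =
     (if absolutely_continuous \<mu> \<pi> \<and> integrable \<pi> (entropy_density (exp 1) \<mu> \<pi>)
      then ereal (KL_divergence (exp 1) \<mu> \<pi>) else \<infinity>)"

(* The infimum is finite for bounded measurable costs: the product coupling has zero entropy. *)
definition entropic_ot ::
  "('a \<times> 'b \<Rightarrow> real) \<Rightarrow> real \<Rightarrow> 'a measure \<Rightarrow> 'b measure \<Rightarrow> real" where
  "entropic_ot c \<epsilon> \<alpha> \<beta> =
     real_of_ereal (INF \<pi>\<in>couplings \<alpha> \<beta>.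
       ereal (\<integral>z. c z \<partial>\<pi>) + ereal \<epsilon> * relative_entropy \<pi> (\<alpha> \<Otimes>\<^sub>M \<beta>))"

(* The law of x i for i uniform on {..<n}, as a measure on the measurable space of \<mu>. *)
definition empirical :: "'a measure \<Rightarrow> nat \<Rightarrow> (nat \<Rightarrow> 'a) \<Rightarrow> 'a measure" where
  "empirical \<mu> n x = distr (uniform_count_measure {..<n}) \<mu> x"

lemma emeasure_empirical:
  assumes "\<And>i. i < n \<Longrightarrow> x i \<in> space \<mu>" "A \<in> sets \<mu>" "0 < n"
  shows "emeasure (empirical \<mu> n x) A = ennreal ((1 / real n) * (\<Sum>i<n. indicator A (x i)))"
proof -
  have "x \<in> measurable (uniform_count_measure {..<n}) \<mu>"
    using assms by (auto simp: measurable_def space_uniform_count_measure sets_uniform_count_measure)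
  then have "emeasure (empirical \<mu> n x) A =
      emeasure (uniform_count_measure {..<n}) (x -` A \<inter> {..<n})"
    using assms by (simp add: empirical_def emeasure_distr space_uniform_count_measure)
  also have "\<dots> = ennreal (real (card (x -` A \<inter> {..<n})) / real n)"
    by (subst emeasure_uniform_count_measure)
       (auto simp: ennreal_of_nat_eq_real_of_nat divide_ennreal assms)
  also have "real (card (x -` A \<inter> {..<n})) = (\<Sum>i<n. indicator A (x i))"
    by (simp add: indicator_def sum.If_cases Int_def vimage_def conj_commute)
  finally show ?thesis by simp
qed

(* The law of n independent pairs (X i, Y i), each distributed according to \<alpha> \<otimes> \<beta>. *)
definition samples :: "nat \<Rightarrow> 'a measure \<Rightarrow> 'b measure \<Rightarrow> (nat \<Rightarrow> 'a \<times> 'b) measure" where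
  "samples n \<alpha> \<beta> = PiM {..<n} (\<lambda>_. \<alpha> \<Otimes>\<^sub>M \<beta>)"

definition sampling_error ::
  "('a \<times> 'b \<Rightarrow> real) \<Rightarrow> real \<Rightarrow> 'a measure \<Rightarrow> 'b measure \<Rightarrow> nat \<Rightarrow> (nat \<Rightarrow> 'a \<times> 'b) \<Rightarrow> real" where
  "sampling_error c \<epsilon> \<alpha> \<beta> n \<omega> =
     \<bar>entropic_ot c \<epsilon> \<alpha> \<beta> -
      entropic_ot c \<epsilon> (empirical \<alpha> n (\<lambda>i. fst (\<omega> i))) (empirical \<beta> n (\<lambda>i. snd (\<omega> i)))\<bar>"

definition expected_error ::
  "('a \<times> 'b \<Rightarrow> real) \<Rightarrow> real \<Rightarrow> 'a measure \<Rightarrow> 'b measure \<Rightarrow> nat \<Rightarrow> real" where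
  "expected_error c \<epsilon> \<alpha> \<beta> n = (\<integral>\<omega>. sampling_error c \<epsilon> \<alpha> \<beta> n \<omega> \<partial>samples n \<alpha> \<beta>)"

(* Iterated partial derivative along a list of basis vectors. *)
primrec partial_deriv :: "'a::euclidean_space list \<Rightarrow> ('a \<Rightarrow> real) \<Rightarrow> 'a \<Rightarrow> real" where
  "partial_deriv [] f = f"
| "partial_deriv (b # bs) f = (\<lambda>z. frechet_derivative (partial_deriv bs f) (at z) b)"

(* C^\<infinity> on a not necessarily open set: C^\<infinity> on an open neighbourhood. Frechet differentiability of
   all iterated partial derivatives makes them all continuous. *)
definition smooth_on :: "'a::euclidean_space set \<Rightarrow> ('a \<Rightarrow> real) \<Rightarrow> bool" where
  "smooth_on S f \<longleftrightarrow>
     (\<exists>U. open U \<and> S \<subseteq> U \<and>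
        (\<forall>bs. set bs \<subseteq> Basis \<longrightarrow> (\<forall>z\<in>U. partial_deriv bs f differentiable (at z))))"

definition deriv_values :: "'a::euclidean_space set \<Rightarrow> ('a \<Rightarrow> real) \<Rightarrow> nat \<Rightarrow> real set" where
  "deriv_values S f k =
     {\<bar>partial_deriv bs f z\<bar> | bs z. set bs \<subseteq> Basis \<and> length bs = k \<and> z \<in> S}"

(* Meaningful only when deriv_values S f k is bounded above, which is assumed below. *)
definition deriv_norm :: "'a::euclidean_space set \<Rightarrow> ('a \<Rightarrow> real) \<Rightarrow> nat \<Rightarrow> real" where
  "deriv_norm S f k = Sup (deriv_values S f k)"

definition ot_setting ::
  "(real^'n) set \<Rightarrow> (real^'n) set \<Rightarrow> (real^'n) measure \<Rightarrow> (real^'n) measure \<Rightarrow>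
   ((real^'n) \<times> (real^'n) \<Rightarrow> real) \<Rightarrow> real \<Rightarrow> bool" where
  "ot_setting X Y \<alpha> \<beta> c L \<longleftrightarrow>
     bounded X \<and> bounded Y \<and> prob_measure_on X \<alpha> \<and> prob_measure_on Y \<beta> \<and>
     smooth_on (X \<times> Y) c \<and> L-lipschitz_on (X \<times> Y) c \<and>
     (\<forall>k\<le>CARD('n) div 2. bdd_above (deriv_values (X \<times> Y) c k))"

definition deriv_norms ::
  "(real^'n) set \<Rightarrow> (real^'n) set \<Rightarrow> ((real^'n) \<times> (real^'n) \<Rightarrow> real) \<Rightarrow> real list" where
  "deriv_norms X Y c = map (deriv_norm (X \<times> Y) c) [0..<Suc (CARD('n) div 2)]"

definition kappa ::
  "(real^'n) set \<Rightarrow> (real^'n) set \<Rightarrow> ((real^'n) \<times> (real^'n) \<Rightarrow> real) \<Rightarrow> real \<Rightarrow> real" where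
  "kappa X Y c L = 2 * L * diameter X + deriv_norm (X \<times> Y) c 0"

end

theory Submission
  imports Defs
begin

text \<open>
  Let \<open>M\<close> bound \<open>\<bar>c\<bar>\<close> on \<open>X \<times> Y\<close>. The regularized cost has a concave dual, whose maximizers \<open>(f, g)\<close>
  solve the Schroedinger system: the density \<open>p(x, y) = exp ((f x + g y - c (x, y)) / \<epsilon>)\<close> with
  respect to \<open>\<alpha> \<otimes> \<beta>\<close> integrates to one in each variable separately. A solution, normalized to be
  bounded by a multiple of \<open>M\<close>, exists for all probability measures (\<open>schrodinger_system_solvable\<close>),
  because the alternating best responses contract the oscillation of a potential. For every
  solution the regularized cost equals \<open>\<integral>f d\<alpha> + \<integral>g d\<beta>\<close> (\<open>entropic_ot_eq_dual\<close>). Both facts apply to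
  \<open>(\<alpha>, \<beta>)\<close> and to the empirical pair alike.

  Let \<open>D\<^sub>n\<close> be the dual functional of the empirical problem and evaluate it at the population
  potentials \<open>(f, g)\<close>. These are deterministic, which reduces the stochastic part to averages of fixed
  functions. Since \<open>D\<^sub>n\<close> is concave and its maximum is the
  empirical cost, \<open>max D\<^sub>n - D\<^sub>n (f, g)\<close> is nonnegative and at most the gradient of \<open>D\<^sub>n\<close> at \<open>(f, g)\<close>
  paired with the displacement to the maximizer (\<open>discrete_dual_gap\<close>). The displacement is at most
  \<open>4 M\<close> and \<open>6 M\<close> in the two components. The gradient consists of the averages of \<open>1 - p(X\<^sub>i, Y\<^sub>j)\<close> over
  \<open>j\<close>, respectively over \<open>i\<close>, and these averages are centered precisely because \<open>p\<close> integrates to one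
  in each variable. The remaining difference \<open>D\<^sub>n (f, g) - W\<^sub>\<epsilon>(\<alpha>, \<beta>)\<close> is also a combination of centered
  averages, of \<open>f\<close>, of \<open>g\<close> and of \<open>\<epsilon> (p - 1)\<close>. A centered average of \<open>n\<close> terms bounded by \<open>B\<close> has
  expected absolute value at most \<open>B / \<surd>n\<close> (\<open>centered_average_bound\<close>), so only the size of \<open>p\<close> is left.

  The potential \<open>f\<close> inherits the oscillation of \<open>c\<close> in \<open>x\<close>, which is at most \<open>L \<bar>X\<bar>\<close>. Hence
  \<open>p(x, y)\<close> and \<open>p(x', y)\<close> differ at most by the factor \<open>exp (2 L \<bar>X\<bar> / \<epsilon>)\<close>, and since \<open>p(\<cdot>, y)\<close> has mean
  one it is bounded by that factor (\<open>plan_density_bound\<close>). Altogether the expected error is at most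
  \<open>26 M exp (2 L \<bar>X\<bar> / \<epsilon>) / \<surd>n\<close>. All three asserted bounds follow from this one: \<open>2 L \<bar>X\<bar> \<le> \<kappa>\<close>, the
  factors \<open>1 + 1 / \<epsilon> ^ \<lfloor>d/2\<rfloor>\<close> and, for \<open>\<epsilon> < 1\<close>, \<open>1 / \<epsilon> ^ \<lfloor>d/2\<rfloor>\<close> are at least one, and the exponential
  is at most \<open>exp 1\<close> once \<open>\<epsilon> \<ge> 2 L \<bar>X\<bar>\<close>.
\<close>

section \<open>The soft minimum transform\<close>

text \<open>
  The best response to a dual potential \<open>u\<close>, with the regularization parameter scaled to one: it is
  the only choice of \<open>v z\<close> for which \<open>exp (u x + v z - k x z)\<close> integrates to one in \<open>x\<close>.
\<close>
definition softmin :: "'a measure \<Rightarrow> ('a \<Rightarrow> 'b \<Rightarrow> real) \<Rightarrow> ('a \<Rightarrow> real) \<Rightarrow> 'b \<Rightarrow> real" where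
  "softmin \<mu> k u z = - ln (\<integral>x. exp (u x - k x z) \<partial>\<mu>)"

locale bounded_kernel = prob_space \<mu> for \<mu> :: "'a measure" +
  fixes N :: "'b measure" and k :: "'a \<Rightarrow> 'b \<Rightarrow> real" and M :: real
  assumes measurable_kernel: "(\<lambda>(x, z). k x z) \<in> borel_measurable (\<mu> \<Otimes>\<^sub>M N)"
    and kernel_bound: "x \<in> space \<mu> \<Longrightarrow> z \<in> space N \<Longrightarrow> \<bar>k x z\<bar> \<le> M"
begin

definition admissible :: "('a \<Rightarrow> real) \<Rightarrow> bool" where
  "admissible u \<longleftrightarrow> u \<in> borel_measurable \<mu> \<and> (\<exists>B. \<forall>x\<in>space \<mu>. \<bar>u x\<bar> \<le> B)"

lemma measurable_kernel_section [measurable]: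
  assumes "z \<in> space N" shows "(\<lambda>x. k x z) \<in> borel_measurable \<mu>"
  using measurable_compose[OF measurable_Pair2'[OF assms] measurable_kernel] by simp

lemma integrable_exp:
  assumes "admissible u" "z \<in> space N"
  shows "integrable \<mu> (\<lambda>x. exp (u x - k x z))"
proof -
  obtain B where B: "\<forall>x\<in>space \<mu>. \<bar>u x\<bar> \<le> B" and [measurable]: "u \<in> borel_measurable \<mu>"
    using assms(1) by (auto simp: admissible_def)
  have "\<bar>u x - k x z\<bar> \<le> B + M" if "x \<in> space \<mu>" for x
    using B kernel_bound[OF that assms(2)] that by fastforce
  then have "u x - k x z \<le> B + M" if "x \<in> space \<mu>" for x
    using that abs_le_D1 by blast
  then show ?thesis
    using assms(2) by (intro integrable_const_bound[where B="exp (B + M)"]) auto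
qed

lemma integral_exp_pos:
  assumes "admissible u" "z \<in> space N"
  shows "0 < (\<integral>x. exp (u x - k x z) \<partial>\<mu>)"
proof -
  obtain B where B: "\<forall>x\<in>space \<mu>. \<bar>u x\<bar> \<le> B"
    using assms(1) by (auto simp: admissible_def)
  have "- (B + M) \<le> u x - k x z" if "x \<in> space \<mu>" for x
    using B kernel_bound[OF that assms(2)] that by fastforce
  then have "(\<integral>x. exp (- (B + M)) \<partial>\<mu>) \<le> (\<integral>x. exp (u x - k x z) \<partial>\<mu>)"
    using integrable_exp[OF assms] by (intro integral_mono) auto
  moreover have "(\<integral>x. exp (- (B + M)) \<partial>\<mu>) = exp (- (B + M))"
    by (simp add: prob_space)
  ultimately show ?thesis
    using exp_gt_zero[of "- (B + M)"] by linarith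
qed

lemma exp_softmin:
  assumes "admissible u" "z \<in> space N"
  shows "exp (- softmin \<mu> k u z) = (\<integral>x. exp (u x - k x z) \<partial>\<mu>)"
  using integral_exp_pos[OF assms] by (simp add: softmin_def)

lemma measurable_softmin [measurable]:
  assumes [measurable]: "u \<in> borel_measurable \<mu>"
  shows "softmin \<mu> k u \<in> borel_measurable N"
proof -
  have [measurable]: "(\<lambda>(z, x). k x z) \<in> borel_measurable (N \<Otimes>\<^sub>M \<mu>)"
    using measurable_compose[OF measurable_pair_swap' measurable_kernel] by (simp add: case_prod_beta')
  have "(\<lambda>z. \<integral>x. exp (u x - k x z) \<partial>\<mu>) \<in> borel_measurable N"
    by measurable
  then show ?thesis
    unfolding softmin_def[abs_def] by measurable
qed

lemma softmin_antimono:
  assumes "admissible u" "admissible v" "z \<in> space N" "\<And>x. x \<in> space \<mu> \<Longrightarrow> v x \<le> u x + d"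
  shows "softmin \<mu> k u z \<le> softmin \<mu> k v z + d"
proof -
  have "exp (- softmin \<mu> k v z) \<le> (\<integral>x. exp d * exp (u x - k x z) \<partial>\<mu>)"
    unfolding exp_softmin[OF assms(2,3)]
  proof (intro integral_mono)
    show "exp (v x - k x z) \<le> exp d * exp (u x - k x z)" if "x \<in> space \<mu>" for x
      using assms(4)[OF that] by (simp flip: exp_add)
  qed (simp_all add: integrable_exp assms(1-3))
  also have "\<dots> = exp (d - softmin \<mu> k u z)"
    unfolding integral_mult_right_zero exp_softmin[OF assms(1,3), symmetric] by (simp flip: exp_add)
  finally show ?thesis by simp
qed

lemma softmin_oscillation:
  assumes "admissible u" "z \<in> space N" "z' \<in> space N" "\<And>x. x \<in> space \<mu> \<Longrightarrow> k x z - k x z' \<le> d"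
  shows "softmin \<mu> k u z - softmin \<mu> k u z' \<le> d"
proof -
  have "exp (- softmin \<mu> k u z') \<le> (\<integral>x. exp d * exp (u x - k x z) \<partial>\<mu>)"
    unfolding exp_softmin[OF assms(1,3)]
  proof (intro integral_mono)
    show "exp (u x - k x z') \<le> exp d * exp (u x - k x z)" if "x \<in> space \<mu>" for x
      using assms(4)[OF that] by (simp flip: exp_add)
  qed (simp_all add: integrable_exp assms(1-3))
  also have "\<dots> = exp (d - softmin \<mu> k u z)"
    unfolding integral_mult_right_zero exp_softmin[OF assms(1,2), symmetric] by (simp flip: exp_add)
  finally show ?thesis by simp
qed

lemma kernel_oscillation:
  assumes "x \<in> space \<mu>" "z \<in> space N" "z' \<in> space N"
  shows "k x z - k x z' \<le> 2 * M"
  using kernel_bound[OF assms(1,2)] kernel_bound[OF assms(1,3)] by linarith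

text \<open>
  Passing from \<open>z\<close> to \<open>z'\<close> changes the weight \<open>exp (- k x z)\<close> at most by the factor \<open>exp (2 M)\<close> and so
  the normalized weights at most by \<open>exp (4 M)\<close>. The averages of \<open>exp (v - u)\<close> under the weights of
  \<open>z\<close> and of \<open>z'\<close> thus share a common part of mass \<open>exp (- 4 M)\<close>, and only the rest of the mass can
  contribute to the oscillation.
\<close>
lemma softmin_contraction:
  assumes u: "admissible u" and v: "admissible v" and z: "z \<in> space N" "z' \<in> space N"
    and m: "\<And>x. x \<in> space \<mu> \<Longrightarrow> m \<le> v x - u x" and d: "\<And>x. x \<in> space \<mu> \<Longrightarrow> v x - u x \<le> m + d"
  shows "(softmin \<mu> k u z - softmin \<mu> k v z) - (softmin \<mu> k u z' - softmin \<mu> k v z')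
           \<le> (1 - exp (- 4 * M)) * d"
proof -
  let ?I = "\<lambda>w z. \<integral>x. exp (w x - k x z) \<partial>\<mu>"
  let ?t = "softmin \<mu> k u z - softmin \<mu> k v z" and ?s = "softmin \<mu> k u z' - softmin \<mu> k v z'"
  let ?\<rho> = "exp (- 4 * M)"
  have ratio: "exp (softmin \<mu> k u z - softmin \<mu> k v z) = ?I v z / ?I u z" if "z \<in> space N" for z
    using exp_softmin[OF u that, symmetric] exp_softmin[OF v that, symmetric] by (simp flip: exp_diff)
  have "0 \<le> M" using kernel_bound[OF _ z(1)] not_empty by fastforce
  have pos: "0 < ?I u z" "0 < ?I u z'" using integral_exp_pos u z by auto
  have "exp (- 2 * M) * (?I v z - exp m * ?I u z)
      = (\<integral>x. exp (- 2 * M) * (exp (v x - k x z) - exp m * exp (u x - k x z)) \<partial>\<mu>)"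
    using integrable_exp u v z by simp
  also have "\<dots> \<le> (\<integral>x. exp (v x - k x z') - exp m * exp (u x - k x z') \<partial>\<mu>)"
  proof (intro integral_mono)
    fix x assume x: "x \<in> space \<mu>"
    have "exp (- 2 * M) * exp (- k x z) \<le> exp (- k x z')"
      using kernel_oscillation[OF x z(2,1)] by (simp flip: exp_add)
    moreover have "0 \<le> exp (v x) - exp m * exp (u x)"
      using m[OF x] by (simp flip: exp_add)
    ultimately have "(exp (v x) - exp m * exp (u x)) * (exp (- 2 * M) * exp (- k x z))
        \<le> (exp (v x) - exp m * exp (u x)) * exp (- k x z')"
      by (rule mult_left_mono)
    then show "exp (- 2 * M) * (exp (v x - k x z) - exp m * exp (u x - k x z))
        \<le> exp (v x - k x z') - exp m * exp (u x - k x z')"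
      by (simp add: exp_diff exp_minus field_simps)
  qed (auto simp: integrable_exp u v z)
  also have "\<dots> = ?I v z' - exp m * ?I u z'"
    using integrable_exp u v z by simp
  finally have num: "exp (- 2 * M) * (?I v z - exp m * ?I u z) \<le> ?I v z' - exp m * ?I u z'" .
  have den: "exp (- 2 * M) * ?I u z' \<le> ?I u z"
    using softmin_oscillation[OF u z(1,2) kernel_oscillation] z
    unfolding exp_softmin[OF u z(1), symmetric] exp_softmin[OF u z(2), symmetric]
    by (simp flip: exp_add)
  have tm: "m \<le> ?t" using softmin_antimono[OF v u z(1), of "-m"] m by fastforce
  have td: "?t \<le> m + d" using softmin_antimono[OF u v z(1), of "m+d"] d by fastforce
  have nn: "0 \<le> ?I v z - exp m * ?I u z"
  proof -
    have "exp m \<le> ?I v z / ?I u z"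
      using tm unfolding ratio[OF z(1), symmetric] by simp
    then show ?thesis using pos by (simp add: field_simps)
  qed
  have nn': "0 \<le> ?I v z' - exp m * ?I u z'"
    by (rule order_trans[OF mult_nonneg_nonneg[OF _ nn] num]) simp
  \<comment> \<open>Convexity of the exponential function turns the common part of the averages into a common part of their logarithms.\<close>
  have "exp (?\<rho> * ?t + (1 - ?\<rho>) * m) \<le> ?\<rho> * exp ?t + (1 - ?\<rho>) * exp m"
    using convex_onD[OF exp_convex, of ?\<rho> m ?t] \<open>0 \<le> M\<close> by (simp add: algebra_simps)
  also have "\<dots> = exp m + ?\<rho> * ((?I v z - exp m * ?I u z) / ?I u z)"
    unfolding ratio[OF z(1)] using pos by (simp add: field_simps)
  also have "\<dots> \<le> exp m + (?I v z' - exp m * ?I u z') / ?I u z'"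
  proof -
    have "?\<rho> * ((?I v z - exp m * ?I u z) / ?I u z)
       = (exp (- 2 * M) * (?I v z - exp m * ?I u z)) * (exp (- 2 * M) / ?I u z)"
      by (simp flip: exp_add)
    also have "\<dots> \<le> (?I v z' - exp m * ?I u z') * (1 / ?I u z')"
      proof (intro mult_mono num nn')
        show "exp (- 2 * M) / ?I u z \<le> 1 / ?I u z'"
          using den pos by (simp add: field_simps)
        show "0 \<le> exp (- 2 * M) / ?I u z" using pos by simp
      qed
    finally show ?thesis by simp
  qed
  also have "\<dots> = exp ?s"
    unfolding ratio[OF z(2)] using pos by (simp add: field_simps)
  finally have "?\<rho> * ?t + (1 - ?\<rho>) * m \<le> ?s" by simp
  moreover have "(1 - ?\<rho>) * (?t - m) \<le> (1 - ?\<rho>) * d"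
    using td \<open>0 \<le> M\<close> by (intro mult_left_mono) auto
  ultimately show ?thesis by (simp add: algebra_simps)
qed

end

section \<open>Solvability of the Schroedinger system\<close>

text \<open>
  The conclusion of \<open>softmin_contraction\<close> bounds differences between pairs of points, its hypothesis
  asks for an enclosing interval; this closes the loop for the iteration.
\<close>
lemma oscillation_interval:
  fixes d :: "'a \<Rightarrow> real"
  assumes "S \<noteq> {}" "\<And>x x'. x \<in> S \<Longrightarrow> x' \<in> S \<Longrightarrow> d x - d x' \<le> \<delta>"
  obtains m where "\<And>x. x \<in> S \<Longrightarrow> m \<le> d x" "\<And>x. x \<in> S \<Longrightarrow> d x \<le> m + \<delta>"
proof -
  obtain x0 where x0: "x0 \<in> S" using assms(1) by auto
  have bdd: "bdd_below (d ` S)"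
    using assms(2)[OF x0] by (intro bdd_belowI2[where m="d x0 - \<delta>"]) (simp add: algebra_simps)
  have "d x - \<delta> \<le> Inf (d ` S)" if "x \<in> S" for x
    using assms(2)[OF that] x0 by (intro cINF_greatest) (auto simp: algebra_simps)
  then show ?thesis
    using that[of "Inf (d ` S)"] cINF_lower[OF bdd] by (force simp: algebra_simps)
qed

lemma (in prob_space) integral_exp_tendsto:
  fixes w :: "nat \<Rightarrow> 'a \<Rightarrow> real"
  assumes [measurable]: "\<And>j. w j \<in> borel_measurable M" "v \<in> borel_measurable M"
    and lim: "\<And>x. x \<in> space M \<Longrightarrow> (\<lambda>j. w j x) \<longlonglongrightarrow> v x"
    and bnd: "\<And>j x. x \<in> space M \<Longrightarrow> w j x \<le> b"
  shows "(\<lambda>j. \<integral>x. exp (w j x) \<partial>M) \<longlonglongrightarrow> (\<integral>x. exp (v x) \<partial>M)"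
proof (rule integral_dominated_convergence[where w="\<lambda>_. exp b"])
  show "AE x in M. (\<lambda>j. exp (w j x)) \<longlonglongrightarrow> exp (v x)"
    using lim by (intro AE_I2 tendsto_exp) auto
qed (use bnd in auto)

context bounded_kernel
begin

lemma softmin_tendsto:
  assumes w: "\<And>j. w j \<in> borel_measurable \<mu>" "\<And>j x. x \<in> space \<mu> \<Longrightarrow> \<bar>w j x\<bar> \<le> b"
    and lim: "\<And>x. x \<in> space \<mu> \<Longrightarrow> (\<lambda>j. w j x) \<longlonglongrightarrow> u x"
    and u: "admissible u" and z: "z \<in> space N"
  shows "(\<lambda>j. softmin \<mu> k (w j) z) \<longlonglongrightarrow> softmin \<mu> k u z"
proof -
  note [measurable] = w(1) measurable_kernel_section[OF z]
  have [measurable]: "u \<in> borel_measurable \<mu>" using u by (simp add: admissible_def)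
  have "w j x - k x z \<le> b + M" if "x \<in> space \<mu>" for j x
    using w(2)[OF that, of j] kernel_bound[OF that z] by linarith
  then have "(\<lambda>j. \<integral>x. exp (w j x - k x z) \<partial>\<mu>) \<longlonglongrightarrow> (\<integral>x. exp (u x - k x z) \<partial>\<mu>)"
    using lim by (intro integral_exp_tendsto[where b="b + M"] tendsto_intros) auto
  then show ?thesis
    unfolding softmin_def using integral_exp_pos[OF u z] by (intro tendsto_intros) auto
qed

lemma admissible_bound: "u \<in> borel_measurable \<mu> \<Longrightarrow> (\<And>x. x \<in> space \<mu> \<Longrightarrow> \<bar>u x\<bar> \<le> B) \<Longrightarrow> admissible u"
  by (auto simp: admissible_def)

lemma softmin_bound:
  assumes "u \<in> borel_measurable \<mu>" "\<And>x. x \<in> space \<mu> \<Longrightarrow> \<bar>u x\<bar> \<le> B" "z \<in> space N"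
  shows "\<bar>softmin \<mu> k u z\<bar> \<le> B + M"
proof -
  have u: "admissible u" using assms by (auto intro: admissible_bound)
  have le: "u x - k x z \<le> B + M" "- (B + M) \<le> u x - k x z" if "x \<in> space \<mu>" for x
    using assms(2)[OF that] kernel_bound[OF that assms(3)] by linarith+
  have "exp (- softmin \<mu> k u z) \<le> (\<integral>x. exp (B + M) \<partial>\<mu>)"
    unfolding exp_softmin[OF u assms(3)] using le(1)
    by (intro integral_mono) (auto simp: integrable_exp u assms(3))
  moreover have "(\<integral>x. exp (- (B + M)) \<partial>\<mu>) \<le> exp (- softmin \<mu> k u z)"
    unfolding exp_softmin[OF u assms(3)] using le(2)
    by (intro integral_mono) (auto simp: integrable_exp u assms(3))
  ultimately have "exp (- softmin \<mu> k u z) \<le> exp (B + M)" "exp (- (B + M)) \<le> exp (- softmin \<mu> k u z)"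
    by (simp_all add: prob_space)
  then show ?thesis by auto
qed

end

text \<open>
  The fixed point equation determines \<open>u\<close> only up to an additive constant, so the alternating best
  response is iterated with the value at \<open>x0\<close> reset to zero after each round. The oscillation of the
  increments then decays geometrically; as they vanish at \<open>x0\<close>, so do their absolute values, and the
  iterates converge pointwise. They stay bounded by \<open>2 M\<close>, the largest oscillation of a soft minimum,
  so dominated convergence carries the equation to the limit.
\<close>
lemma schrodinger_fixed_point:
  fixes \<alpha> :: "'a measure" and \<beta> :: "'b measure" and k :: "'a \<Rightarrow> 'b \<Rightarrow> real"
  assumes \<alpha>: "prob_space \<alpha>" and \<beta>: "prob_space \<beta>"
    and k [measurable]: "(\<lambda>(x, y). k x y) \<in> borel_measurable (\<alpha> \<Otimes>\<^sub>M \<beta>)"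
    and bound: "\<And>x y. x \<in> space \<alpha> \<Longrightarrow> y \<in> space \<beta> \<Longrightarrow> \<bar>k x y\<bar> \<le> M"
    and x0: "x0 \<in> space \<alpha>"
  obtains u r where "u \<in> borel_measurable \<alpha>" "\<And>x. x \<in> space \<alpha> \<Longrightarrow> \<bar>u x\<bar> \<le> 2 * M" "u x0 = 0"
    "\<And>x. x \<in> space \<alpha> \<Longrightarrow> softmin \<beta> (\<lambda>y x. k x y) (softmin \<alpha> k u) x = u x + r"
proof -
  interpret A: bounded_kernel \<alpha> \<beta> k M
    using \<alpha> k bound by (simp add: bounded_kernel_def bounded_kernel_axioms_def)
  have "(\<lambda>(y, x). k x y) \<in> borel_measurable (\<beta> \<Otimes>\<^sub>M \<alpha>)"
    using measurable_compose[OF measurable_pair_swap' k] by (simp add: case_prod_beta')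
  then interpret B: bounded_kernel \<beta> \<alpha> "\<lambda>y x. k x y" M
    using \<beta> bound by (simp add: bounded_kernel_def bounded_kernel_axioms_def)
  define F where "F u = softmin \<beta> (\<lambda>y x. k x y) (softmin \<alpha> k u)" for u
  define G where "G u x = F u x - F u x0" for u x
  define w where "w j = (G ^^ j) (\<lambda>_. 0)" for j
  define \<theta> where "\<theta> = 1 - exp (- 4 * M)"
  have "0 \<le> M" using bound x0 B.not_empty by fastforce
  then have \<theta>: "0 \<le> \<theta>" "\<theta> < 1" by (auto simp: \<theta>_def)
  have w_Suc: "w (Suc j) = G (w j)" for j by (simp add: w_def)
  have w: "w j \<in> borel_measurable \<alpha> \<and> (\<forall>x\<in>space \<alpha>. \<bar>w j x\<bar> \<le> 2 * M) \<and> w j x0 = 0" for j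
  proof (induction j)
    case 0
    then show ?case using \<open>0 \<le> M\<close> by (simp add: w_def)
  next
    case (Suc j)
    then have [measurable]: "w j \<in> borel_measurable \<alpha>" by simp
    have "B.admissible (softmin \<alpha> k (w j))"
      using Suc A.softmin_bound[of "w j"] by (intro B.admissible_bound) auto
    from B.softmin_oscillation[OF this _ _ B.kernel_oscillation] x0
    have "\<bar>G (w j) x\<bar> \<le> 2 * M" if "x \<in> space \<alpha>" for x
      unfolding G_def F_def using that by (smt (verit, best))
    then show ?case by (auto simp: w_Suc G_def[abs_def] F_def)
  qed
  then have [measurable]: "w j \<in> borel_measurable \<alpha>" for j by simp
  have adm: "A.admissible (w j)" "B.admissible (softmin \<alpha> k (w j))" for j
    using w[of j] A.softmin_bound[of "w j"] by (auto intro!: A.admissible_bound B.admissible_bound)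
  have step: "(w (Suc j) x - w j x) - (w (Suc j) x' - w j x') \<le> \<theta> ^ j * (4 * M)"
    if "x \<in> space \<alpha>" "x' \<in> space \<alpha>" for j x x'
    using that
  proof (induction j arbitrary: x x')
    case 0
    have "w 0 = (\<lambda>_. 0)" by (simp add: w_def)
    moreover have "\<bar>w (Suc 0) x\<bar> \<le> 2 * M" "\<bar>w (Suc 0) x'\<bar> \<le> 2 * M"
      using w[of "Suc 0"] 0 by blast+
    ultimately show ?case by simp
  next
    case (Suc j)
    let ?d = "\<lambda>x. w (Suc j) x - w j x"
    have osc: "?d x - ?d x' \<le> \<theta> ^ j * (4 * M)" if "x \<in> space \<alpha>" "x' \<in> space \<alpha>" for x x'
      using Suc.IH[OF that] .
    obtain m where m: "\<And>x. x \<in> space \<alpha> \<Longrightarrow> m \<le> ?d x"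
        "\<And>x. x \<in> space \<alpha> \<Longrightarrow> ?d x \<le> m + \<theta> ^ j * (4 * M)"
      using oscillation_interval[of "space \<alpha>" ?d, OF A.not_empty osc] by blast
    have "(F (w (Suc j)) x - F (w j) x) - (F (w (Suc j)) x' - F (w j) x')
        \<le> \<theta> * (\<theta> ^ j * (4 * M))"
      unfolding F_def \<theta>_def
    proof (rule B.softmin_contraction[OF adm(2) adm(2) Suc.prems])
      fix y assume y: "y \<in> space \<beta>"
      show "m \<le> softmin \<alpha> k (w j) y - softmin \<alpha> k (w (Suc j)) y"
        using A.softmin_antimono[OF adm(1) adm(1) y, of j "Suc j" "- m"] m(1) by fastforce
      show "softmin \<alpha> k (w j) y - softmin \<alpha> k (w (Suc j)) y \<le> m + (1 - exp (- 4 * M)) ^ j * (4 * M)"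
        using A.softmin_antimono[OF adm(1) adm(1) y, of "Suc j" j "m + \<theta> ^ j * (4 * M)"] m(2)
        by (fastforce simp: \<theta>_def)
    qed
    then show ?case by (simp add: w_Suc G_def)
  qed
  have "convergent (\<lambda>j. w j x)" if x: "x \<in> space \<alpha>" for x
  proof -
    have *: "norm (w (Suc j) x - w j x) \<le> \<theta> ^ j * (4 * M)" for j
      using step[OF x x0, of j] step[OF x0 x, of j] w[of j] w[of "Suc j"] by auto
    have "summable (\<lambda>j. \<theta> ^ j * (4 * M))"
      using \<theta> by (intro summable_mult2 summable_geometric) auto
    then have "summable (\<lambda>j. w (Suc j) x - w j x)"
      using * by (rule summable_comparison_test')
    then have "convergent (\<lambda>n. w n x - w 0 x)"
      by (simp add: summable_iff_convergent sum_lessThan_telescope[where f="\<lambda>j. w j x"])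
    then have "convergent (\<lambda>n. (w n x - w 0 x) + w 0 x)"
      by (intro convergent_add convergent_const)
    then show ?thesis by simp
  qed
  then have lim: "(\<lambda>j. w j x) \<longlonglongrightarrow> lim (\<lambda>j. w j x)" if "x \<in> space \<alpha>" for x
    using that by (simp add: convergent_LIMSEQ_iff)
  define u where "u x = lim (\<lambda>j. w j x)" for x
  have u_meas [measurable]: "u \<in> borel_measurable \<alpha>"
    unfolding u_def[abs_def] by measurable
  have u_bound: "\<bar>u x\<bar> \<le> 2 * M" if "x \<in> space \<alpha>" for x
    using w that by (intro LIMSEQ_le_const2[OF tendsto_rabs[OF lim[OF that, folded u_def]]]) auto
  have u0: "u x0 = 0"
    using w by (simp add: u_def lim_const)
  have Fu: "(\<lambda>j. F (w j) x) \<longlonglongrightarrow> F u x" if x: "x \<in> space \<alpha>" for x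
    unfolding F_def
  proof (rule B.softmin_tendsto[where b="3 * M"])
    show "(\<lambda>j. softmin \<alpha> k (w j) y) \<longlonglongrightarrow> softmin \<alpha> k u y" if "y \<in> space \<beta>" for y
      using w u_bound lim that by (intro A.softmin_tendsto[where b="2 * M"]) (auto intro!: A.admissible_bound simp: u_def)
    show "\<bar>softmin \<alpha> k (w j) y\<bar> \<le> 3 * M" if "y \<in> space \<beta>" for j y
      using A.softmin_bound[of "w j" "2 * M"] w that by fastforce
    show "B.admissible (softmin \<alpha> k u)"
      using A.softmin_bound[of u "2 * M"] u_bound by (auto intro!: B.admissible_bound)
  qed (use x in auto)
  have "F u x = u x + F u x0" if x: "x \<in> space \<alpha>" for x
  proof -
    have "(\<lambda>j. w (Suc j) x) \<longlonglongrightarrow> F u x - F u x0"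
      unfolding w_Suc G_def by (intro tendsto_diff Fu x x0)
    moreover have "(\<lambda>j. w (Suc j) x) \<longlonglongrightarrow> u x"
      using lim[OF x] unfolding u_def by (rule LIMSEQ_Suc)
    ultimately show ?thesis using LIMSEQ_unique by fastforce
  qed
  then show ?thesis
    using that[of u "F u x0"] u_bound u0 by (simp add: F_def)
qed

text \<open>
  If \<open>v\<close> is the best response to the fixed point \<open>u\<close>, then \<open>exp (u + v - k)\<close> integrates to one in \<open>x\<close>
  and to the constant \<open>exp (- r)\<close> in \<open>y\<close>, where \<open>r\<close> is the additive defect of the fixed point. Integrating over both
  variables in the two possible orders gives \<open>exp (- r) = 1\<close>.
\<close>
lemma schrodinger_system_solvable:
  fixes \<alpha> :: "'a measure" and \<beta> :: "'b measure" and k :: "'a \<Rightarrow> 'b \<Rightarrow> real"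
  assumes \<alpha>: "prob_space \<alpha>" and \<beta>: "prob_space \<beta>"
    and k [measurable]: "(\<lambda>(x, y). k x y) \<in> borel_measurable (\<alpha> \<Otimes>\<^sub>M \<beta>)"
    and bound: "\<And>x y. x \<in> space \<alpha> \<Longrightarrow> y \<in> space \<beta> \<Longrightarrow> \<bar>k x y\<bar> \<le> M"
    and x0: "x0 \<in> space \<alpha>"
  obtains u v where "u \<in> borel_measurable \<alpha>" "v \<in> borel_measurable \<beta>" "u x0 = 0"
    "\<And>x. x \<in> space \<alpha> \<Longrightarrow> \<bar>u x\<bar> \<le> 2 * M" "\<And>y. y \<in> space \<beta> \<Longrightarrow> \<bar>v y\<bar> \<le> 3 * M"
    "\<And>x. x \<in> space \<alpha> \<Longrightarrow> (\<integral>y. exp (u x + v y - k x y) \<partial>\<beta>) = 1"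
    "\<And>y. y \<in> space \<beta> \<Longrightarrow> (\<integral>x. exp (u x + v y - k x y) \<partial>\<alpha>) = 1"
proof -
  interpret A: bounded_kernel \<alpha> \<beta> k M
    using \<alpha> k bound by (simp add: bounded_kernel_def bounded_kernel_axioms_def)
  have "(\<lambda>(y, x). k x y) \<in> borel_measurable (\<beta> \<Otimes>\<^sub>M \<alpha>)"
    using measurable_compose[OF measurable_pair_swap' k] by (simp add: case_prod_beta')
  then interpret B: bounded_kernel \<beta> \<alpha> "\<lambda>y x. k x y" M
    using \<beta> bound by (simp add: bounded_kernel_def bounded_kernel_axioms_def)
  interpret pair_prob_space \<alpha> \<beta> ..
  obtain u r where u: "u \<in> borel_measurable \<alpha>" "\<And>x. x \<in> space \<alpha> \<Longrightarrow> \<bar>u x\<bar> \<le> 2 * M" "u x0 = 0"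
    and fixpt: "\<And>x. x \<in> space \<alpha> \<Longrightarrow> softmin \<beta> (\<lambda>y x. k x y) (softmin \<alpha> k u) x = u x + r"
    using schrodinger_fixed_point[OF assms] by metis
  note [measurable] = u(1)
  define v where "v = softmin \<alpha> k u"
  have [measurable]: "v \<in> borel_measurable \<beta>" by (simp add: v_def)
  have u_adm: "A.admissible u" by (rule A.admissible_bound[OF u(1,2)])
  have v_bound: "\<bar>v y\<bar> \<le> 3 * M" if "y \<in> space \<beta>" for y
    using A.softmin_bound[OF u(1,2) that] by (simp add: v_def)
  then have v_adm: "B.admissible v" by (intro B.admissible_bound) auto
  let ?p = "\<lambda>x y. exp (u x + v y - k x y)"
  have p_\<alpha>: "(\<integral>x. ?p x y \<partial>\<alpha>) = 1" if "y \<in> space \<beta>" for y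
  proof -
    have "(\<integral>x. ?p x y \<partial>\<alpha>) = (\<integral>x. exp (v y) * exp (u x - k x y) \<partial>\<alpha>)"
      by (simp add: algebra_simps flip: exp_add)
    also have "\<dots> = 1"
      unfolding integral_mult_right_zero A.exp_softmin[OF u_adm that, symmetric]
      by (simp add: v_def flip: exp_add)
    finally show ?thesis .
  qed
  have p_\<beta>: "(\<integral>y. ?p x y \<partial>\<beta>) = exp (- r)" if "x \<in> space \<alpha>" for x
  proof -
    have "(\<integral>y. ?p x y \<partial>\<beta>) = (\<integral>y. exp (u x) * exp (v y - k x y) \<partial>\<beta>)"
      by (simp add: algebra_simps flip: exp_add)
    also have "\<dots> = exp (- r)"
      unfolding integral_mult_right_zero B.exp_softmin[OF v_adm that, symmetric]
      using fixpt[OF that] by (simp add: v_def flip: exp_add)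
    finally show ?thesis .
  qed
  have "integrable (\<alpha> \<Otimes>\<^sub>M \<beta>) (\<lambda>(x, y). ?p x y)"
  proof (rule P.integrable_const_bound[where B="exp (6 * M)"])
    have "u x + v y - k x y \<le> 6 * M" if "x \<in> space \<alpha>" "y \<in> space \<beta>" for x y
      using u(2)[OF that(1)] v_bound[OF that(2)] bound[OF that] by linarith
    then show "AE z in \<alpha> \<Otimes>\<^sub>M \<beta>. norm (case z of (x, y) \<Rightarrow> ?p x y) \<le> exp (6 * M)"
      by (intro AE_I2) (auto simp: space_pair_measure)
  qed measurable
  from Fubini_integral[OF this]
  have "(\<integral>y. 1 \<partial>\<beta>) = (\<integral>x. exp (- r) \<partial>\<alpha>)"
    using p_\<alpha> p_\<beta> by (simp cong: Bochner_Integration.integral_cong)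
  then have "exp (- r) = 1" by (simp add: A.prob_space B.prob_space)
  then show ?thesis
    using that[of u v] u v_bound p_\<alpha> p_\<beta> by simp
qed

section \<open>Entropic duality\<close>

text \<open>
  Nonnegativity of the relative entropy of \<open>\<pi>\<close> with respect to the measure with density \<open>exp \<phi>\<close>. For the
  density \<open>D\<close> of \<open>\<pi>\<close> it is the pointwise inequality \<open>exp s \<ge> 1 + s\<close> at \<open>s = \<phi> - ln D\<close>, multiplied by
  \<open>D\<close> and integrated.
\<close>
lemma (in prob_space) gibbs_variational_bound:
  assumes "prob_space \<pi>" and ac: "absolutely_continuous M \<pi>" "sets \<pi> = sets M"
    and int: "integrable \<pi> (entropy_density (exp 1) M \<pi>)"
    and \<phi> [measurable]: "\<phi> \<in> borel_measurable M" and bnd: "\<And>x. x \<in> space M \<Longrightarrow> \<bar>\<phi> x\<bar> \<le> B"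
    and one: "(\<integral>x. exp (\<phi> x) \<partial>M) = 1"
  shows "(\<integral>x. \<phi> x \<partial>\<pi>) \<le> KL_divergence (exp 1) M \<pi>"
proof -
  interpret \<pi>: prob_space \<pi> by fact
  have "finite_measure \<pi>" by unfold_locales
  from real_RN_deriv[OF this ac] obtain D
    where D: "random_variable borel D" "AE x in M. RN_deriv M \<pi> x = ennreal (D x)"
      "AE x in \<pi>. 0 < D x" "\<And>x. 0 \<le> D x"
    by blast
  note [measurable] = D(1) and [measurable_cong] = ac(2)
  have "\<pi> = density M (RN_deriv M \<pi>)"
    using ac by (rule density_RN_deriv[symmetric])
  also have "\<dots> = density M D"
    using D by (auto intro!: density_cong)
  finally have \<pi>: "\<pi> = density M D" .
  have "(\<integral>\<^sup>+x. ennreal (D x) \<partial>M) = emeasure (density M D) (space M)"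
    by (subst emeasure_density) (auto intro!: nn_integral_cong)
  then have nn1: "(\<integral>\<^sup>+x. ennreal (D x) \<partial>M) = 1"
    using \<pi>.emeasure_space_1 sets_eq_imp_space_eq[OF ac(2)] \<pi> by simp
  then have D1: "integrable M D" "(\<integral>x. D x \<partial>M) = 1"
    using D(4) by (auto intro!: integrableI_nonneg simp: integral_eq_nn_integral)
  have ln: "AE x in \<pi>. entropy_density (exp 1) M \<pi> x = ln (D x)"
    using absolutely_continuous_AE[OF ac(2,1) D(2)] by eventually_elim (use D(4) in \<open>simp add: entropy_density_def log_def\<close>)
  have [measurable]: "entropy_density (exp 1) M \<pi> \<in> borel_measurable \<pi>"
    using measurable_entropy_density[of "exp 1" M \<pi>] by measurable
  have ms: "(\<lambda>x. ln (D x)) \<in> borel_measurable \<pi>" "\<phi> \<in> borel_measurable \<pi>"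
    by measurable
  have "integrable \<pi> (\<lambda>x. ln (D x))"
    using int by (rule integrable_cong_AE_imp[OF _ ms(1)]) (use ln in \<open>auto elim: eventually_mono\<close>)
  then have intD: "integrable M (\<lambda>x. D x * ln (D x))"
    unfolding \<pi> using D(4) by (subst (asm) integrable_real_density) auto
  have "integrable \<pi> \<phi>"
    using ms(2) bnd sets_eq_imp_space_eq[OF ac(2)] by (intro \<pi>.integrable_const_bound[where B=B]) auto
  then have int\<phi>: "integrable M (\<lambda>x. D x * \<phi> x)"
    unfolding \<pi> using D(4) by (subst (asm) integrable_real_density) auto
  have int1: "integrable M (\<lambda>x. exp (\<phi> x))"
    using one not_integrable_integral_eq by fastforce
  have "(\<integral>x. \<phi> x \<partial>\<pi>) = (\<integral>x. D x * \<phi> x \<partial>M)"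
    unfolding \<pi> using D(4) by (subst integral_real_density) auto
  also have "\<dots> = (\<integral>x. D x * \<phi> x + D x - exp (\<phi> x) \<partial>M)"
    using int\<phi> D1 int1 one by simp
  also have "\<dots> \<le> (\<integral>x. D x * ln (D x) \<partial>M)"
  proof (intro integral_mono)
    fix x
    show "D x * \<phi> x + D x - exp (\<phi> x) \<le> D x * ln (D x)"
    proof (cases "D x = 0")
      case False
      then have pos: "0 < D x" using D(4)[of x] by linarith
      have "\<phi> x - ln (D x) \<le> exp (\<phi> x) / D x - 1"
        using exp_ge_add_one_self[of "\<phi> x - ln (D x)"] pos by (simp add: exp_diff)
      then show ?thesis using pos by (simp add: field_simps)
    qed simp
  qed (use int\<phi> intD int1 D1 in auto)
  also have "\<dots> = (\<integral>x. ln (D x) \<partial>\<pi>)"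
    unfolding \<pi> using D(4) by (subst integral_real_density) auto
  also have "\<dots> = KL_divergence (exp 1) M \<pi>"
    unfolding KL_divergence_def using ln ms by (intro integral_cong_AE) (auto elim: eventually_mono)
  finally show ?thesis .
qed

text \<open>
  The case of equality in \<open>gibbs_variational_bound\<close>.
\<close>
lemma (in prob_space) gibbs_density_entropy:
  assumes \<phi> [measurable]: "\<phi> \<in> borel_measurable M" and bnd: "\<And>x. x \<in> space M \<Longrightarrow> \<bar>\<phi> x\<bar> \<le> B"
    and "prob_space (density M (\<lambda>x. ennreal (exp (\<phi> x))))" (is "prob_space ?\<pi>")
  shows "absolutely_continuous M ?\<pi>" "integrable ?\<pi> (entropy_density (exp 1) M ?\<pi>)"
    "KL_divergence (exp 1) M ?\<pi> = (\<integral>x. \<phi> x \<partial>?\<pi>)"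
proof -
  interpret \<pi>: prob_space ?\<pi> by fact
  show "absolutely_continuous M ?\<pi>" by (rule absolutely_continuousI_density) simp
  have "AE x in M. ennreal (exp (\<phi> x)) = RN_deriv M ?\<pi> x"
    by (rule RN_deriv_unique) auto
  then have "AE x in M. entropy_density (exp 1) M ?\<pi> x = \<phi> x"
  proof eventually_elim
    case (elim x)
    then have "enn2real (RN_deriv M ?\<pi> x) = exp (\<phi> x)"
      by (metis enn2real_ennreal exp_ge_zero)
    then show ?case by (simp add: entropy_density_def log_def)
  qed
  then have ed: "AE x in ?\<pi>. entropy_density (exp 1) M ?\<pi> x = \<phi> x"
    by (simp add: AE_density)
  have "integrable ?\<pi> \<phi>"
    using bnd by (intro \<pi>.integrable_const_bound[where B=B]) auto
  then show "integrable ?\<pi> (entropy_density (exp 1) M ?\<pi>)"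
    by (rule integrable_cong_AE_imp) (use ed in \<open>auto elim: eventually_mono\<close>)
  show "KL_divergence (exp 1) M ?\<pi> = (\<integral>x. \<phi> x \<partial>?\<pi>)"
    unfolding KL_divergence_def using ed by (intro integral_cong_AE) auto
qed

locale bounded_cost = pair_prob_space \<alpha> \<beta>
  for \<alpha> :: "'a measure" and \<beta> :: "'b measure" +
  fixes c :: "'a \<times> 'b \<Rightarrow> real" and \<epsilon> M :: real
  assumes \<epsilon>_pos: "0 < \<epsilon>"
    and measurable_cost [measurable]: "c \<in> borel_measurable (\<alpha> \<Otimes>\<^sub>M \<beta>)"
    and cost_bound: "x \<in> space \<alpha> \<Longrightarrow> y \<in> space \<beta> \<Longrightarrow> \<bar>c (x, y)\<bar> \<le> M"

text \<open>
  A solution of the Schroedinger system. The bounds \<open>2 M\<close> and \<open>3 M\<close> record a normalization: adding a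
  constant to \<open>f\<close> and subtracting it from \<open>g\<close> preserves the two integral equations.
\<close>
locale entropic_potentials = bounded_cost \<alpha> \<beta> c \<epsilon> M
  for \<alpha> :: "'a measure" and \<beta> :: "'b measure" and c :: "'a \<times> 'b \<Rightarrow> real" and \<epsilon> M :: real +
  fixes f :: "'a \<Rightarrow> real" and g :: "'b \<Rightarrow> real"
  assumes measurable_potentials [measurable]: "f \<in> borel_measurable \<alpha>" "g \<in> borel_measurable \<beta>"
    and f_bound: "x \<in> space \<alpha> \<Longrightarrow> \<bar>f x\<bar> \<le> 2 * M"
    and g_bound: "y \<in> space \<beta> \<Longrightarrow> \<bar>g y\<bar> \<le> 3 * M"
    and first_marginal: "x \<in> space \<alpha> \<Longrightarrow> (\<integral>y. exp ((f x + g y - c (x, y)) / \<epsilon>) \<partial>\<beta>) = 1"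
    and second_marginal: "y \<in> space \<beta> \<Longrightarrow> (\<integral>x. exp ((f x + g y - c (x, y)) / \<epsilon>) \<partial>\<alpha>) = 1"
begin

definition log_density :: "'a \<times> 'b \<Rightarrow> real" where
  "log_density z = (f (fst z) + g (snd z) - c z) / \<epsilon>"

definition optimal_plan :: "('a \<times> 'b) measure" where
  "optimal_plan = density (\<alpha> \<Otimes>\<^sub>M \<beta>) (\<lambda>z. ennreal (exp (log_density z)))"

lemma measurable_log_density [measurable]: "log_density \<in> borel_measurable (\<alpha> \<Otimes>\<^sub>M \<beta>)"
  unfolding log_density_def[abs_def] by measurable

lemma M_nonneg: "0 \<le> M"
  using f_bound M1.not_empty by fastforce

lemma log_density_bound:
  assumes "z \<in> space (\<alpha> \<Otimes>\<^sub>M \<beta>)" shows "\<bar>log_density z\<bar> \<le> 6 * M / \<epsilon>"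
proof -
  have "\<bar>f (fst z) + g (snd z) - c z\<bar> \<le> 6 * M"
    using assms f_bound[of "fst z"] g_bound[of "snd z"] cost_bound[of "fst z" "snd z"]
    by (auto simp: space_pair_measure)
  then show ?thesis
    using \<epsilon>_pos by (simp add: log_density_def abs_divide divide_right_mono)
qed

text \<open>
  The integral equations already contain integrability: a Bochner integral that does not exist is
  zero.
\<close>
lemma nn_marginals:
  shows "x \<in> space \<alpha> \<Longrightarrow> (\<integral>\<^sup>+y. ennreal (exp (log_density (x, y))) \<partial>\<beta>) = 1"
    and "y \<in> space \<beta> \<Longrightarrow> (\<integral>\<^sup>+x. ennreal (exp (log_density (x, y))) \<partial>\<alpha>) = 1"
proof -
  assume x: "x \<in> space \<alpha>"
  have "integrable \<beta> (\<lambda>y. exp (log_density (x, y)))"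
    using first_marginal[OF x] not_integrable_integral_eq[of \<beta>] by (force simp: log_density_def)
  then show "(\<integral>\<^sup>+y. ennreal (exp (log_density (x, y))) \<partial>\<beta>) = 1"
    using first_marginal[OF x] by (subst nn_integral_eq_integral) (auto simp: log_density_def)
next
  assume y: "y \<in> space \<beta>"
  have "integrable \<alpha> (\<lambda>x. exp (log_density (x, y)))"
    using second_marginal[OF y] not_integrable_integral_eq[of \<alpha>] by (force simp: log_density_def)
  then show "(\<integral>\<^sup>+x. ennreal (exp (log_density (x, y))) \<partial>\<alpha>) = 1"
    using second_marginal[OF y] by (subst nn_integral_eq_integral) (auto simp: log_density_def)
qed

lemma sets_optimal_plan [measurable_cong, simp]: "sets optimal_plan = sets (\<alpha> \<Otimes>\<^sub>M \<beta>)"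
  by (simp add: optimal_plan_def)

lemma distr_optimal_plan: "distr optimal_plan \<alpha> fst = \<alpha>" "distr optimal_plan \<beta> snd = \<beta>"
proof -
  have "emeasure (distr optimal_plan \<alpha> fst) A = emeasure \<alpha> A" if A [measurable]: "A \<in> sets \<alpha>" for A
  proof -
    have sub: "fst -` A \<inter> space optimal_plan \<in> sets (\<alpha> \<Otimes>\<^sub>M \<beta>)"
      using measurable_sets[of fst optimal_plan \<alpha> A] by simp
    have "emeasure (distr optimal_plan \<alpha> fst) A = emeasure optimal_plan (fst -` A \<inter> space optimal_plan)"
      by (simp add: emeasure_distr)
    also have "\<dots> = (\<integral>\<^sup>+z. ennreal (exp (log_density z)) * indicator A (fst z) \<partial>(\<alpha> \<Otimes>\<^sub>M \<beta>))"
      using sub sets.sets_into_space[OF sub] unfolding optimal_plan_def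
      by (subst emeasure_density) (auto intro!: nn_integral_cong simp: indicator_def)
    also have "\<dots> = (\<integral>\<^sup>+x. \<integral>\<^sup>+y. ennreal (exp (log_density (x, y))) * indicator A x \<partial>\<beta> \<partial>\<alpha>)"
      by (subst M2.nn_integral_fst[symmetric]) auto
    also have "\<dots> = (\<integral>\<^sup>+x. indicator A x \<partial>\<alpha>)"
      by (intro nn_integral_cong) (simp add: nn_integral_multc nn_marginals)
    finally show ?thesis by simp
  qed
  then show "distr optimal_plan \<alpha> fst = \<alpha>"
    by (intro measure_eqI) auto
  have "emeasure (distr optimal_plan \<beta> snd) A = emeasure \<beta> A" if A [measurable]: "A \<in> sets \<beta>" for A
  proof -
    have sub: "snd -` A \<inter> space optimal_plan \<in> sets (\<alpha> \<Otimes>\<^sub>M \<beta>)"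
      using measurable_sets[of snd optimal_plan \<beta> A] by simp
    have "emeasure (distr optimal_plan \<beta> snd) A = emeasure optimal_plan (snd -` A \<inter> space optimal_plan)"
      by (simp add: emeasure_distr)
    also have "\<dots> = (\<integral>\<^sup>+z. ennreal (exp (log_density z)) * indicator A (snd z) \<partial>(\<alpha> \<Otimes>\<^sub>M \<beta>))"
      using sub sets.sets_into_space[OF sub] unfolding optimal_plan_def
      by (subst emeasure_density) (auto intro!: nn_integral_cong simp: indicator_def)
    also have "\<dots> = (\<integral>\<^sup>+y. \<integral>\<^sup>+x. ennreal (exp (log_density (x, y))) * indicator A y \<partial>\<alpha> \<partial>\<beta>)"
      by (subst nn_integral_snd[symmetric]) auto
    also have "\<dots> = (\<integral>\<^sup>+y. indicator A y \<partial>\<beta>)"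
      by (intro nn_integral_cong) (simp add: nn_integral_multc nn_marginals)
    finally show ?thesis by simp
  qed
  then show "distr optimal_plan \<beta> snd = \<beta>"
    by (intro measure_eqI) auto
qed

lemma optimal_plan_coupling: "optimal_plan \<in> couplings \<alpha> \<beta>"
  using prob_space_distrD[of fst optimal_plan \<alpha>] distr_optimal_plan M1.prob_space_axioms
  by (simp add: couplings_def)

text \<open>
  The marginals of a coupling fix the integrals of \<open>f\<close> and \<open>g\<close>. Up to a constant common to all couplings, the transport
  cost is therefore \<open>- \<epsilon>\<close> times the integral of \<open>log_density\<close>, so that minimizing the
  regularized cost amounts to the Gibbs inequality.
\<close>
lemma log_density_coupling:
  assumes "\<pi> \<in> couplings \<alpha> \<beta>"
  shows "(\<integral>z. c z \<partial>\<pi>) + \<epsilon> * (\<integral>z. log_density z \<partial>\<pi>) = (\<integral>x. f x \<partial>\<alpha>) + (\<integral>y. g y \<partial>\<beta>)"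
proof -
  interpret \<pi>: prob_space \<pi> using assms by (simp add: couplings_def)
  have s [measurable_cong]: "sets \<pi> = sets (\<alpha> \<Otimes>\<^sub>M \<beta>)"
    and d: "distr \<pi> \<alpha> fst = \<alpha>" "distr \<pi> \<beta> snd = \<beta>"
    using assms by (auto simp: couplings_def)
  note sp = sets_eq_imp_space_eq[OF s]
  have i: "integrable \<pi> c" "integrable \<pi> (\<lambda>z. f (fst z))" "integrable \<pi> (\<lambda>z. g (snd z))"
  proof -
    show "integrable \<pi> c" using cost_bound sp
      by (intro \<pi>.integrable_const_bound[where B=M]) (auto simp: space_pair_measure)
    show "integrable \<pi> (\<lambda>z. f (fst z))" using f_bound sp
      by (intro \<pi>.integrable_const_bound[where B="2 * M"]) (auto simp: space_pair_measure)
    show "integrable \<pi> (\<lambda>z. g (snd z))" using g_bound sp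
      by (intro \<pi>.integrable_const_bound[where B="3 * M"]) (auto simp: space_pair_measure)
  qed
  have "\<epsilon> * (\<integral>z. log_density z \<partial>\<pi>) = (\<integral>z. f (fst z) + g (snd z) - c z \<partial>\<pi>)"
    unfolding log_density_def using \<epsilon>_pos by simp
  also have "\<dots> = (\<integral>z. f (fst z) \<partial>\<pi>) + (\<integral>z. g (snd z) \<partial>\<pi>) - (\<integral>z. c z \<partial>\<pi>)"
    using i by simp
  also have "(\<integral>z. f (fst z) \<partial>\<pi>) = (\<integral>x. f x \<partial>\<alpha>)"
    using integral_distr[of fst \<pi> \<alpha> f] d(1) by simp
  also have "(\<integral>z. g (snd z) \<partial>\<pi>) = (\<integral>y. g y \<partial>\<beta>)"
    using integral_distr[of snd \<pi> \<beta> g] d(2) by simp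
  finally show ?thesis by simp
qed

theorem entropic_ot_eq_dual: "entropic_ot c \<epsilon> \<alpha> \<beta> = (\<integral>x. f x \<partial>\<alpha>) + (\<integral>y. g y \<partial>\<beta>)"
proof -
  let ?V = "(\<integral>x. f x \<partial>\<alpha>) + (\<integral>y. g y \<partial>\<beta>)"
  let ?obj = "\<lambda>\<pi>. ereal (\<integral>z. c z \<partial>\<pi>) + ereal \<epsilon> * relative_entropy \<pi> (\<alpha> \<Otimes>\<^sub>M \<beta>)"
  have pr: "prob_space optimal_plan"
    using optimal_plan_coupling by (simp add: couplings_def)
  have "(\<integral>\<^sup>+z. ennreal (exp (log_density z)) \<partial>(\<alpha> \<Otimes>\<^sub>M \<beta>)) = 1"
    using prob_space.emeasure_space_1[OF pr] by (simp add: optimal_plan_def emeasure_density cong: nn_integral_cong)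
  then have one: "(\<integral>z. exp (log_density z) \<partial>(\<alpha> \<Otimes>\<^sub>M \<beta>)) = 1"
    by (simp add: integral_eq_nn_integral)
  have "(INF \<pi>\<in>couplings \<alpha> \<beta>. ?obj \<pi>) = ereal ?V"
  proof (rule antisym)
    note e = P.gibbs_density_entropy[OF measurable_log_density log_density_bound pr[unfolded optimal_plan_def], folded optimal_plan_def]
    have "?obj optimal_plan = ereal ?V"
      using e log_density_coupling[OF optimal_plan_coupling] by (simp add: relative_entropy_def)
    then show "(INF \<pi>\<in>couplings \<alpha> \<beta>. ?obj \<pi>) \<le> ereal ?V"
      using INF_lower[OF optimal_plan_coupling, of ?obj] by simp
    show "ereal ?V \<le> (INF \<pi>\<in>couplings \<alpha> \<beta>. ?obj \<pi>)"
    proof (rule INF_greatest)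
      fix \<pi> assume \<pi>: "\<pi> \<in> couplings \<alpha> \<beta>"
      show "ereal ?V \<le> ?obj \<pi>"
      proof (cases "absolutely_continuous (\<alpha> \<Otimes>\<^sub>M \<beta>) \<pi> \<and> integrable \<pi> (entropy_density (exp 1) (\<alpha> \<Otimes>\<^sub>M \<beta>) \<pi>)")
        case True
        then have "(\<integral>z. log_density z \<partial>\<pi>) \<le> KL_divergence (exp 1) (\<alpha> \<Otimes>\<^sub>M \<beta>) \<pi>"
          using \<pi> log_density_bound one
          by (intro P.gibbs_variational_bound[where B="6 * M / \<epsilon>"]) (auto simp: couplings_def)
        then have "\<epsilon> * (\<integral>z. log_density z \<partial>\<pi>) \<le> \<epsilon> * KL_divergence (exp 1) (\<alpha> \<Otimes>\<^sub>M \<beta>) \<pi>"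
          using \<epsilon>_pos by simp
        then show ?thesis
          using True log_density_coupling[OF \<pi>] by (simp add: relative_entropy_def)
      next
        case False
        then have "relative_entropy \<pi> (\<alpha> \<Otimes>\<^sub>M \<beta>) = \<infinity>" by (auto simp: relative_entropy_def)
        then show ?thesis using \<epsilon>_pos by simp
      qed
    qed
  qed
  then show ?thesis by (simp add: entropic_ot_def)
qed

end

lemma entropic_potentials_exist:
  fixes \<alpha> :: "'a measure" and \<beta> :: "'b measure" and c :: "'a \<times> 'b \<Rightarrow> real"
  assumes "prob_space \<alpha>" "prob_space \<beta>" "0 < \<epsilon>"
    and [measurable]: "c \<in> borel_measurable (\<alpha> \<Otimes>\<^sub>M \<beta>)"
    and bound: "\<And>x y. x \<in> space \<alpha> \<Longrightarrow> y \<in> space \<beta> \<Longrightarrow> \<bar>c (x, y)\<bar> \<le> M"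
  obtains f g where "entropic_potentials \<alpha> \<beta> c \<epsilon> M f g"
proof -
  interpret \<alpha>: prob_space \<alpha> by fact
  interpret \<beta>: prob_space \<beta> by fact
  interpret pair_prob_space \<alpha> \<beta> ..
  obtain x0 where x0: "x0 \<in> space \<alpha>" using \<alpha>.not_empty by auto
  have m: "(\<lambda>(x, y). c (x, y) / \<epsilon>) \<in> borel_measurable (\<alpha> \<Otimes>\<^sub>M \<beta>)" by simp
  have b: "\<bar>c (x, y) / \<epsilon>\<bar> \<le> M / \<epsilon>" if "x \<in> space \<alpha>" "y \<in> space \<beta>" for x y
    using bound[OF that] \<open>0 < \<epsilon>\<close> by (simp add: abs_divide divide_right_mono)
  obtain u v where uv: "u \<in> borel_measurable \<alpha>" "v \<in> borel_measurable \<beta>" "u x0 = 0"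
    "\<And>x. x \<in> space \<alpha> \<Longrightarrow> \<bar>u x\<bar> \<le> 2 * (M / \<epsilon>)" "\<And>y. y \<in> space \<beta> \<Longrightarrow> \<bar>v y\<bar> \<le> 3 * (M / \<epsilon>)"
    "\<And>x. x \<in> space \<alpha> \<Longrightarrow> (\<integral>y. exp (u x + v y - c (x, y) / \<epsilon>) \<partial>\<beta>) = 1"
    "\<And>y. y \<in> space \<beta> \<Longrightarrow> (\<integral>x. exp (u x + v y - c (x, y) / \<epsilon>) \<partial>\<alpha>) = 1"
    
    by (rule schrodinger_system_solvable[OF assms(1,2) m _ x0]) (erule (1) b, blast)
  note [measurable] = uv(1,2)
  have e: "(\<epsilon> * a + \<epsilon> * b - d) / \<epsilon> = a + b - d / \<epsilon>" for a b d
    using \<open>0 < \<epsilon>\<close> by (simp add: field_simps)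
  have "entropic_potentials \<alpha> \<beta> c \<epsilon> M (\<lambda>x. \<epsilon> * u x) (\<lambda>y. \<epsilon> * v y)"
  proof
    show "\<bar>\<epsilon> * u x\<bar> \<le> 2 * M" if "x \<in> space \<alpha>" for x
      using uv(4)[OF that] \<open>0 < \<epsilon>\<close> by (simp add: abs_mult field_simps)
    show "\<bar>\<epsilon> * v y\<bar> \<le> 3 * M" if "y \<in> space \<beta>" for y
      using uv(5)[OF that] \<open>0 < \<epsilon>\<close> by (simp add: abs_mult field_simps)
  qed (use assms uv(6,7) in \<open>simp_all add: e\<close>)
  then show ?thesis by (rule that)
qed

section \<open>The empirical problem and its dual\<close>

lemma sets_empirical [simp, measurable_cong]: "sets (empirical \<mu> n x) = sets \<mu>"
  by (simp add: empirical_def)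

lemma space_empirical [simp]: "space (empirical \<mu> n x) = space \<mu>"
  by (simp add: empirical_def)

lemma measurable_sample_points:
  assumes "\<And>i. i < n \<Longrightarrow> x i \<in> space \<mu>"
  shows "x \<in> measurable (uniform_count_measure {..<n}) \<mu>"
  using assms by (auto simp: measurable_def space_uniform_count_measure sets_uniform_count_measure)

lemma prob_space_empirical:
  assumes "\<And>i. i < n \<Longrightarrow> x i \<in> space \<mu>" "0 < n"
  shows "prob_space (empirical \<mu> n x)"
  unfolding empirical_def using assms
  by (intro prob_space.prob_space_distr prob_space_uniform_count_measure measurable_sample_points) auto

lemma integral_empirical:
  fixes h :: "'a \<Rightarrow> real"
  assumes "\<And>i. i < n \<Longrightarrow> x i \<in> space \<mu>" "h \<in> borel_measurable \<mu>"
  shows "(\<integral>z. h z \<partial>empirical \<mu> n x) = (\<Sum>i<n. h (x i)) / n"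
  unfolding empirical_def
  by (subst integral_distr[OF measurable_sample_points assms(2)])
     (auto simp: assms(1) integral_uniform_count_measure)

text \<open>
  The dual functional of the problem between two empirical measures with \<open>C i j = c (X\<^sub>i, Y\<^sub>j)\<close>. The
  potentials are vectors indexed by the position in the sample and not functions of the sampled
  point, so coinciding sample points may carry different values. This makes the functional depend on
  the sample only through the matrix \<open>C\<close>.
\<close>
definition discrete_dual ::
  "nat \<Rightarrow> real \<Rightarrow> (nat \<Rightarrow> nat \<Rightarrow> real) \<Rightarrow> (nat \<Rightarrow> real) \<Rightarrow> (nat \<Rightarrow> real) \<Rightarrow> real" where
  "discrete_dual n \<epsilon> C f g =
     (\<Sum>i<n. f i) / n + (\<Sum>j<n. g j) / n
     - \<epsilon> * ((\<Sum>i<n. \<Sum>j<n. exp ((f i + g j - C i j) / \<epsilon>)) / (real n)\<^sup>2 - 1)"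

text \<open>
  Concavity of the dual functional: it stays below its tangent at \<open>(f, g)\<close>. The partial derivatives
  there are, up to the factor \<open>1 / n\<close>, one minus the row and column averages of \<open>p\<close>.
\<close>
lemma discrete_dual_tangent:
  fixes f g F G :: "nat \<Rightarrow> real" and C :: "nat \<Rightarrow> nat \<Rightarrow> real"
  assumes n: "0 < n" and \<epsilon>: "0 < \<epsilon>"
  defines "p \<equiv> \<lambda>i j. exp ((f i + g j - C i j) / \<epsilon>)"
  shows "discrete_dual n \<epsilon> C F G \<le> discrete_dual n \<epsilon> C f g
           + (\<Sum>i<n. (F i - f i) * (1 - (\<Sum>j<n. p i j) / n)) / n
           + (\<Sum>j<n. (G j - g j) * (1 - (\<Sum>i<n. p i j) / n)) / n"
proof -
  let ?P = "\<lambda>i j. exp ((F i + G j - C i j) / \<epsilon>)"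
  have tangent: "\<epsilon> * p i j + p i j * (F i - f i) + p i j * (G j - g j) \<le> \<epsilon> * ?P i j" for i j
  proof -
    have "p i j * (1 + ((F i - f i) + (G j - g j)) / \<epsilon>) \<le> p i j * exp (((F i - f i) + (G j - g j)) / \<epsilon>)"
      unfolding p_def by (intro mult_left_mono exp_ge_add_one_self) simp
    also have "\<dots> = ?P i j"
      unfolding p_def using \<epsilon> by (simp add: diff_divide_distrib add_divide_distrib algebra_simps flip: exp_add)
    finally have "\<epsilon> * (p i j * (1 + ((F i - f i) + (G j - g j)) / \<epsilon>)) \<le> \<epsilon> * ?P i j"
      using \<epsilon> by simp
    moreover have "\<epsilon> * (p i j * (1 + ((F i - f i) + (G j - g j)) / \<epsilon>))
        = \<epsilon> * p i j + p i j * (F i - f i) + p i j * (G j - g j)"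
      using \<epsilon> by (simp add: field_simps)
    ultimately show ?thesis by simp
  qed
  have "(\<Sum>i<n. \<Sum>j<n. \<epsilon> * p i j) + (\<Sum>i<n. (F i - f i) * (\<Sum>j<n. p i j)) + (\<Sum>j<n. (G j - g j) * (\<Sum>i<n. p i j))
      = (\<Sum>i<n. \<Sum>j<n. \<epsilon> * p i j + p i j * (F i - f i) + p i j * (G j - g j))"
    using sum.swap[of "\<lambda>i j. p i j * (G j - g j)" "{..<n}" "{..<n}"]
    by (simp add: sum.distrib sum_distrib_left mult.commute)
  also have "\<dots> \<le> (\<Sum>i<n. \<Sum>j<n. \<epsilon> * ?P i j)"
    by (intro sum_mono tangent)
  finally have le: "\<epsilon> * (\<Sum>i<n. \<Sum>j<n. p i j) + (\<Sum>i<n. (F i - f i) * (\<Sum>j<n. p i j))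
      + (\<Sum>j<n. (G j - g j) * (\<Sum>i<n. p i j)) \<le> \<epsilon> * (\<Sum>i<n. \<Sum>j<n. ?P i j)"
    by (simp add: sum_distrib_left)
  have e1: "(\<Sum>i<n. (F i - f i) * (1 - (\<Sum>j<n. p i j) / n)) / n
      = (\<Sum>i<n. F i) / n - (\<Sum>i<n. f i) / n - (\<Sum>i<n. (F i - f i) * (\<Sum>j<n. p i j)) / (real n)\<^sup>2"
    using n by (simp add: right_diff_distrib sum_subtractf diff_divide_distrib power2_eq_square flip: sum_divide_distrib)
  have e2: "(\<Sum>j<n. (G j - g j) * (1 - (\<Sum>i<n. p i j) / n)) / n
      = (\<Sum>j<n. G j) / n - (\<Sum>j<n. g j) / n - (\<Sum>j<n. (G j - g j) * (\<Sum>i<n. p i j)) / (real n)\<^sup>2"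
    using n by (simp add: right_diff_distrib sum_subtractf diff_divide_distrib power2_eq_square flip: sum_divide_distrib)
  have "(\<epsilon> * (\<Sum>i<n. \<Sum>j<n. p i j) + (\<Sum>i<n. (F i - f i) * (\<Sum>j<n. p i j))
      + (\<Sum>j<n. (G j - g j) * (\<Sum>i<n. p i j))) / (real n)\<^sup>2 \<le> (\<epsilon> * (\<Sum>i<n. \<Sum>j<n. ?P i j)) / (real n)\<^sup>2"
    using le by (rule divide_right_mono) simp
  moreover have dual: "discrete_dual n \<epsilon> C f g = (\<Sum>i<n. f i) / n + (\<Sum>j<n. g j) / n
      - \<epsilon> * ((\<Sum>i<n. \<Sum>j<n. p i j) / (real n)\<^sup>2 - 1)"
    by (simp add: discrete_dual_def p_def)
  ultimately show ?thesis
    unfolding e1 e2 dual by (simp add: discrete_dual_def add_divide_distrib right_diff_distrib)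
qed

text \<open>
  The discrete Schroedinger system, which says that the gradient of \<open>discrete_dual\<close> vanishes.
\<close>
definition discrete_potentials ::
  "nat \<Rightarrow> real \<Rightarrow> (nat \<Rightarrow> nat \<Rightarrow> real) \<Rightarrow> (nat \<Rightarrow> real) \<Rightarrow> (nat \<Rightarrow> real) \<Rightarrow> bool" where
  "discrete_potentials n \<epsilon> C f g \<longleftrightarrow>
     (\<forall>i<n. (\<Sum>j<n. exp ((f i + g j - C i j) / \<epsilon>)) = n) \<and>
     (\<forall>j<n. (\<Sum>i<n. exp ((f i + g j - C i j) / \<epsilon>)) = n)"

lemma discrete_dual_potentials:
  assumes "discrete_potentials n \<epsilon> C f g" "0 < n"
  shows "discrete_dual n \<epsilon> C f g = (\<Sum>i<n. f i) / n + (\<Sum>j<n. g j) / n"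
  using assms by (simp add: discrete_dual_def discrete_potentials_def power2_eq_square)

lemma discrete_dual_maximal:
  assumes "discrete_potentials n \<epsilon> C f g" "0 < n" "0 < \<epsilon>"
  shows "discrete_dual n \<epsilon> C F G \<le> discrete_dual n \<epsilon> C f g"
  using discrete_dual_tangent[OF assms(2,3), of C F G f g] assms
  by (simp add: discrete_potentials_def)

text \<open>
  The tangent is taken at the trial potentials \<open>(f, g)\<close>, not at the maximizer, so the right-hand side
  involves \<open>p\<close> for the trial potentials only. In the application these do not depend on the sample,
  and the maximizer enters through the a priori bounds \<open>A\<close> and \<open>B\<close> alone.
\<close>
lemma discrete_dual_gap:
  fixes f g F G :: "nat \<Rightarrow> real" and C :: "nat \<Rightarrow> nat \<Rightarrow> real"
  assumes "discrete_potentials n \<epsilon> C F G" "0 < n" "0 < \<epsilon>"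
    and F: "\<And>i. i < n \<Longrightarrow> \<bar>F i - f i\<bar> \<le> A" and G: "\<And>j. j < n \<Longrightarrow> \<bar>G j - g j\<bar> \<le> B"
  defines "p \<equiv> \<lambda>i j. exp ((f i + g j - C i j) / \<epsilon>)"
  shows "\<bar>discrete_dual n \<epsilon> C F G - discrete_dual n \<epsilon> C f g\<bar>
      \<le> A * ((\<Sum>i<n. \<bar>(\<Sum>j<n. p i j - 1) / n\<bar>) / n) + B * ((\<Sum>j<n. \<bar>(\<Sum>i<n. p i j - 1) / n\<bar>) / n)"
proof -
  have *: "(\<Sum>i<n. u i * (1 - (\<Sum>j<n. q i j) / n)) / n \<le> D * ((\<Sum>i<n. \<bar>(\<Sum>j<n. q i j - 1) / n\<bar>) / n)"
    if u: "\<And>i. i < n \<Longrightarrow> \<bar>u i\<bar> \<le> D" for u D and q :: "nat \<Rightarrow> nat \<Rightarrow> real"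
  proof -
    have "(\<Sum>i<n. u i * (1 - (\<Sum>j<n. q i j) / n)) \<le> (\<Sum>i<n. D * \<bar>(\<Sum>j<n. q i j - 1) / n\<bar>)"
    proof (intro sum_mono)
      fix i assume "i \<in> {..<n}"
      then have i: "i < n" by simp
      have "1 - (\<Sum>j<n. q i j) / n = - ((\<Sum>j<n. q i j - 1) / n)"
        using \<open>0 < n\<close> by (simp add: sum_subtractf field_simps)
      then have "u i * (1 - (\<Sum>j<n. q i j) / n) \<le> \<bar>u i\<bar> * \<bar>(\<Sum>j<n. q i j - 1) / n\<bar>"
        by (metis abs_ge_self abs_minus_cancel abs_mult)
      also have "\<dots> \<le> D * \<bar>(\<Sum>j<n. q i j - 1) / n\<bar>"
        using u[OF i] by (intro mult_right_mono) auto
      finally show "u i * (1 - (\<Sum>j<n. q i j) / n) \<le> D * \<bar>(\<Sum>j<n. q i j - 1) / n\<bar>" .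
    qed
    then have "(\<Sum>i<n. u i * (1 - (\<Sum>j<n. q i j) / n)) / n \<le> (\<Sum>i<n. D * \<bar>(\<Sum>j<n. q i j - 1) / n\<bar>) / n"
      by (rule divide_right_mono) simp
    then show ?thesis
      unfolding sum_distrib_left[symmetric] times_divide_eq_right .
  qed
  have "discrete_dual n \<epsilon> C f g \<le> discrete_dual n \<epsilon> C F G"
    using discrete_dual_maximal assms by blast
  moreover have "discrete_dual n \<epsilon> C F G - discrete_dual n \<epsilon> C f g
      \<le> (\<Sum>i<n. (F i - f i) * (1 - (\<Sum>j<n. p i j) / n)) / n
        + (\<Sum>j<n. (G j - g j) * (1 - (\<Sum>i<n. p i j) / n)) / n"
    using discrete_dual_tangent[OF assms(2,3), of C F G f g] unfolding p_def by simp
  moreover note *[of "\<lambda>i. F i - f i" A p, OF F] *[of "\<lambda>j. G j - g j" B "\<lambda>j i. p i j", OF G]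
  ultimately show ?thesis by linarith
qed

context bounded_cost
begin

abbreviation empirical_ot :: "nat \<Rightarrow> (nat \<Rightarrow> 'a \<times> 'b) \<Rightarrow> real" where
  "empirical_ot n \<omega> \<equiv>
     entropic_ot c \<epsilon> (empirical \<alpha> n (\<lambda>i. fst (\<omega> i))) (empirical \<beta> n (\<lambda>i. snd (\<omega> i)))"

abbreviation sample_cost :: "(nat \<Rightarrow> 'a \<times> 'b) \<Rightarrow> nat \<Rightarrow> nat \<Rightarrow> real" where
  "sample_cost \<omega> i j \<equiv> c (fst (\<omega> i), snd (\<omega> j))"

lemma samples_space: "\<omega> \<in> space (samples n \<alpha> \<beta>) \<Longrightarrow> i < n \<Longrightarrow> \<omega> i \<in> space \<alpha> \<times> space \<beta>"
  by (auto simp: samples_def space_PiM space_pair_measure)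

text \<open>
  The empirical measures live on the measurable spaces of \<open>\<alpha>\<close> and \<open>\<beta>\<close>, so the duality theorem
  applies to them verbatim; restricting the potentials to the sample gives the vectors.
\<close>
lemma empirical_potentials:
  assumes n: "0 < n" and \<omega>: "\<omega> \<in> space (samples n \<alpha> \<beta>)"
  obtains f g where "discrete_potentials n \<epsilon> (sample_cost \<omega>) f g"
    "\<And>i. i < n \<Longrightarrow> \<bar>f i\<bar> \<le> 2 * M" "\<And>j. j < n \<Longrightarrow> \<bar>g j\<bar> \<le> 3 * M"
    "empirical_ot n \<omega> = discrete_dual n \<epsilon> (sample_cost \<omega>) f g"
proof -
  let ?x = "\<lambda>i. fst (\<omega> i)" and ?y = "\<lambda>i. snd (\<omega> i)"
  let ?\<alpha> = "empirical \<alpha> n ?x" and ?\<beta> = "empirical \<beta> n ?y"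
  have x: "?x i \<in> space \<alpha>" and y: "?y i \<in> space \<beta>" if "i < n" for i
    using samples_space[OF \<omega> that] by auto
  have "sets (?\<alpha> \<Otimes>\<^sub>M ?\<beta>) = sets (\<alpha> \<Otimes>\<^sub>M \<beta>)"
    by (intro sets_pair_measure_cong) auto
  from measurable_cong_sets[OF this refl] have "c \<in> borel_measurable (?\<alpha> \<Otimes>\<^sub>M ?\<beta>)"
    using measurable_cost by blast
  then obtain f g where "entropic_potentials ?\<alpha> ?\<beta> c \<epsilon> M f g"
    using entropic_potentials_exist[of ?\<alpha> ?\<beta> \<epsilon> c M] prob_space_empirical[of n] x y n cost_bound \<epsilon>_pos
    by (metis space_empirical)
  then interpret E: entropic_potentials ?\<alpha> ?\<beta> c \<epsilon> M f g .
  have [measurable]: "f \<in> borel_measurable \<alpha>" "g \<in> borel_measurable \<beta>"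
    using E.measurable_potentials by simp_all
  have "(\<Sum>j<n. exp ((f (?x i) + g (?y j) - c (?x i, ?y j)) / \<epsilon>)) = n" if i: "i < n" for i
  proof -
    have [measurable]: "?x i \<in> space \<alpha>" by (rule x[OF i])
    have "(\<lambda>y. exp ((f (?x i) + g y - c (?x i, y)) / \<epsilon>)) \<in> borel_measurable \<beta>"
      by measurable
    from integral_empirical[OF y this] show ?thesis
      using E.first_marginal[of "?x i"] x[OF i] n by (simp add: field_simps)
  qed
  moreover have "(\<Sum>i<n. exp ((f (?x i) + g (?y j) - c (?x i, ?y j)) / \<epsilon>)) = n" if j: "j < n" for j
  proof -
    have [measurable]: "?y j \<in> space \<beta>" by (rule y[OF j])
    have "(\<lambda>x. exp ((f x + g (?y j) - c (x, ?y j)) / \<epsilon>)) \<in> borel_measurable \<alpha>"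
      by measurable
    from integral_empirical[OF x this] show ?thesis
      using E.second_marginal[of "?y j"] y[OF j] n by (simp add: field_simps)
  qed
  ultimately have dp: "discrete_potentials n \<epsilon> (sample_cost \<omega>) (\<lambda>i. f (?x i)) (\<lambda>j. g (?y j))"
    by (simp add: discrete_potentials_def)
  have "empirical_ot n \<omega> = (\<integral>x. f x \<partial>?\<alpha>) + (\<integral>y. g y \<partial>?\<beta>)"
    by (rule E.entropic_ot_eq_dual)
  also have "\<dots> = discrete_dual n \<epsilon> (sample_cost \<omega>) (\<lambda>i. f (?x i)) (\<lambda>j. g (?y j))"
    using x y by (simp add: discrete_dual_potentials[OF dp n] integral_empirical)
  finally show ?thesis
    using that[OF dp] E.f_bound E.g_bound x y by simp
qed

end

section \<open>Averages of centered functions of a sample\<close>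

lemma integral_zero_coordinate:
  fixes F :: "('i \<Rightarrow> 'a) \<Rightarrow> real"
  assumes "prob_space \<mu>" "finite I" "k \<in> I" and F: "integrable (PiM I (\<lambda>_. \<mu>)) F"
    and zero: "\<And>\<omega>. \<omega> \<in> space (PiM (I - {k}) (\<lambda>_. \<mu>)) \<Longrightarrow> (\<integral>z. F (fun_upd \<omega> k z) \<partial>\<mu>) = 0"
  shows "(\<integral>\<omega>. F \<omega> \<partial>PiM I (\<lambda>_. \<mu>)) = 0"
proof -
  interpret prob_space \<mu> by fact
  interpret product_sigma_finite "\<lambda>_::'i. \<mu>" ..
  have I: "insert k (I - {k}) = I" using assms(3) by auto
  have "(\<integral>\<omega>. F \<omega> \<partial>PiM I (\<lambda>_. \<mu>)) = (\<integral>\<omega>. \<integral>z. F (fun_upd \<omega> k z) \<partial>\<mu> \<partial>PiM (I - {k}) (\<lambda>_. \<mu>))"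
    using product_integral_insert[of "I - {k}" k F] assms(2) F unfolding I by simp
  also have "\<dots> = (\<integral>\<omega>. 0 \<partial>PiM (I - {k}) (\<lambda>_. \<mu>))"
    by (intro Bochner_Integration.integral_cong zero refl)
  finally show ?thesis by simp
qed

text \<open>
  In the second moment of \<open>Z\<close> the mixed terms vanish: if \<open>j \<noteq> k\<close>, one of the two indices differs
  from \<open>i\<close>, and integrating out the sample point at that index gives zero by centering. Only the \<open>n\<close>
  diagonal terms remain, each at most \<open>B\<^sup>2\<close>. The term \<open>j = i\<close>, in which both arguments of \<open>h\<close> are the
  same sample point, causes no trouble: it is never the one that is integrated out.
\<close>
lemma centered_average_bound:
  fixes h :: "'a \<Rightarrow> 'a \<Rightarrow> real"
  assumes \<mu>: "prob_space \<mu>" and h: "(\<lambda>(z, w). h z w) \<in> borel_measurable (\<mu> \<Otimes>\<^sub>M \<mu>)"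
    and bound: "\<And>z w. z \<in> space \<mu> \<Longrightarrow> w \<in> space \<mu> \<Longrightarrow> \<bar>h z w\<bar> \<le> B"
    and centered: "\<And>z. z \<in> space \<mu> \<Longrightarrow> (\<integral>w. h z w \<partial>\<mu>) = 0"
    and i: "i < n"
  defines "Z \<equiv> \<lambda>\<omega>. (\<Sum>j<n. h (\<omega> i) (\<omega> j)) / real n"
  shows "integrable (PiM {..<n} (\<lambda>_. \<mu>)) Z"
    "(\<integral>\<omega>. \<bar>Z \<omega>\<bar> \<partial>PiM {..<n} (\<lambda>_. \<mu>)) \<le> B / sqrt n"
proof -
  let ?\<Omega> = "PiM {..<n} (\<lambda>_. \<mu>)"
  interpret \<mu>: prob_space \<mu> by fact
  interpret \<Omega>: prob_space ?\<Omega> by (intro prob_space_PiM \<mu>)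
  have B: "0 \<le> B" using bound \<mu>.not_empty by fastforce
  have n: "0 < n" using i by simp
  have comp: "\<omega> j \<in> space \<mu>" if "\<omega> \<in> space ?\<Omega>" "j < n" for \<omega> j
    using that by (auto simp: space_PiM)
  have hm [measurable]: "(\<lambda>\<omega>. h (\<omega> j) (\<omega> k)) \<in> borel_measurable ?\<Omega>" if "j < n" "k < n" for j k
  proof -
    have "(\<lambda>\<omega>. (\<omega> j, \<omega> k)) \<in> measurable ?\<Omega> (\<mu> \<Otimes>\<^sub>M \<mu>)"
      using that by (intro measurable_Pair measurable_component_singleton) auto
    from measurable_compose[OF this h] show ?thesis by simp
  qed
  have Zm [measurable]: "Z \<in> borel_measurable ?\<Omega>"
    unfolding Z_def using i by (intro borel_measurable_divide borel_measurable_sum hm) auto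
  have Zb: "\<bar>Z \<omega>\<bar> \<le> B" if "\<omega> \<in> space ?\<Omega>" for \<omega>
  proof -
    have "\<bar>\<Sum>j<n. h (\<omega> i) (\<omega> j)\<bar> \<le> (\<Sum>j<n. B)"
      using bound comp[OF that] i by (intro order_trans[OF sum_abs] sum_mono) auto
    then show ?thesis using n by (simp add: Z_def abs_divide field_simps)
  qed
  show Zi: "integrable ?\<Omega> Z"
    using Zb by (intro \<Omega>.integrable_const_bound[where B=B]) auto
  have prod_int: "integrable ?\<Omega> (\<lambda>\<omega>. h (\<omega> i) (\<omega> j) * h (\<omega> i) (\<omega> k))" if "j < n" "k < n" for j k
  proof (rule \<Omega>.integrable_const_bound[where B="B * B"])
    show "AE \<omega> in ?\<Omega>. norm (h (\<omega> i) (\<omega> j) * h (\<omega> i) (\<omega> k)) \<le> B * B"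
      using bound comp i that B by (intro AE_I2) (auto simp: abs_mult intro!: mult_mono)
  qed (use i that in auto)
  have orth: "(\<integral>\<omega>. h (\<omega> i) (\<omega> j) * h (\<omega> i) (\<omega> k) \<partial>?\<Omega>) = 0"
    if jk: "j < n" "k < n" "j \<noteq> k" "k \<noteq> i" for j k
  proof (rule integral_zero_coordinate[OF \<mu>, where k=k])
    fix \<omega> assume "\<omega> \<in> space (PiM ({..<n} - {k}) (\<lambda>_. \<mu>))"
    then have "\<omega> i \<in> space \<mu>" using i jk by (auto simp: space_PiM)
    then show "(\<integral>z. h ((fun_upd \<omega> k z) i) ((fun_upd \<omega> k z) j) * h ((fun_upd \<omega> k z) i) ((fun_upd \<omega> k z) k) \<partial>\<mu>) = 0"
      using jk centered by simp
  qed (use jk prod_int in auto)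
  have cov: "(\<integral>\<omega>. h (\<omega> i) (\<omega> j) * h (\<omega> i) (\<omega> k) \<partial>?\<Omega>) \<le> (if j = k then B\<^sup>2 else 0)"
    if "j < n" "k < n" for j k
  proof (cases "j = k")
    case True
    have "h (\<omega> i) (\<omega> k) * h (\<omega> i) (\<omega> k) \<le> B\<^sup>2" if "\<omega> \<in> space ?\<Omega>" for \<omega>
      using power_mono[of "\<bar>h (\<omega> i) (\<omega> k)\<bar>" B 2] bound comp[OF that] i \<open>k < n\<close>
      by (simp add: power2_eq_square)
    then have "(\<integral>\<omega>. h (\<omega> i) (\<omega> j) * h (\<omega> i) (\<omega> k) \<partial>?\<Omega>) \<le> (\<integral>\<omega>. B\<^sup>2 \<partial>?\<Omega>)"
      using prod_int[OF that] True by (intro integral_mono) auto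
    then show ?thesis using True by (simp add: \<Omega>.prob_space)
  next
    case False
    then show ?thesis
      using orth[of j k] orth[of k j] that by (cases "k = i") (auto simp: mult.commute)
  qed
  have Z2: "(Z \<omega>)\<^sup>2 = (\<Sum>j<n. \<Sum>k<n. h (\<omega> i) (\<omega> j) * h (\<omega> i) (\<omega> k)) / (real n)\<^sup>2" for \<omega>
    by (simp add: Z_def power2_eq_square sum_product)
  have "(\<integral>\<omega>. (Z \<omega>)\<^sup>2 \<partial>?\<Omega>) = (\<Sum>j<n. \<Sum>k<n. \<integral>\<omega>. h (\<omega> i) (\<omega> j) * h (\<omega> i) (\<omega> k) \<partial>?\<Omega>) / (real n)\<^sup>2"
  proof -
    have "(\<integral>\<omega>. (\<Sum>j<n. \<Sum>k<n. h (\<omega> i) (\<omega> j) * h (\<omega> i) (\<omega> k)) \<partial>?\<Omega>)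
        = (\<Sum>j<n. \<integral>\<omega>. (\<Sum>k<n. h (\<omega> i) (\<omega> j) * h (\<omega> i) (\<omega> k)) \<partial>?\<Omega>)"
      by (intro Bochner_Integration.integral_sum Bochner_Integration.integrable_sum prod_int) auto
    also have "\<dots> = (\<Sum>j<n. \<Sum>k<n. \<integral>\<omega>. h (\<omega> i) (\<omega> j) * h (\<omega> i) (\<omega> k) \<partial>?\<Omega>)"
      by (intro sum.cong refl Bochner_Integration.integral_sum prod_int) auto
    finally show ?thesis unfolding Z2 by simp
  qed
  also have "\<dots> \<le> (\<Sum>j<n. \<Sum>k<n. if j = k then B\<^sup>2 else 0) / (real n)\<^sup>2"
    using cov by (intro divide_right_mono sum_mono) auto
  also have "\<dots> = B\<^sup>2 / n"
    using n by (simp add: power2_eq_square)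
  finally have second: "(\<integral>\<omega>. (Z \<omega>)\<^sup>2 \<partial>?\<Omega>) \<le> B\<^sup>2 / n" .
  have "integrable ?\<Omega> (\<lambda>\<omega>. (Z \<omega>)\<^sup>2)"
    unfolding Z2 by (auto intro!: Bochner_Integration.integrable_sum prod_int)
  then have "(\<integral>\<omega>. \<bar>Z \<omega>\<bar> \<partial>?\<Omega>)\<^sup>2 \<le> (\<integral>\<omega>. (Z \<omega>)\<^sup>2 \<partial>?\<Omega>)"
    using \<Omega>.variance_positive[of "\<lambda>\<omega>. \<bar>Z \<omega>\<bar>"] \<Omega>.variance_eq[of "\<lambda>\<omega>. \<bar>Z \<omega>\<bar>"] Zi by simp
  also have "\<dots> \<le> (B / sqrt n)\<^sup>2"
    using second by (simp add: power_divide)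
  finally show "(\<integral>\<omega>. \<bar>Z \<omega>\<bar> \<partial>?\<Omega>) \<le> B / sqrt n"
    by (rule power2_le_imp_le) (use B in simp)
qed

section \<open>Measurability of the empirical cost\<close>

context bounded_cost
begin

lemma empirical_ot_bound:
  assumes "0 < n" "\<omega> \<in> space (samples n \<alpha> \<beta>)"
  shows "\<bar>empirical_ot n \<omega>\<bar> \<le> 5 * M"
proof -
  obtain f g where fg: "discrete_potentials n \<epsilon> (sample_cost \<omega>) f g"
    "\<And>i. i < n \<Longrightarrow> \<bar>f i\<bar> \<le> 2 * M" "\<And>j. j < n \<Longrightarrow> \<bar>g j\<bar> \<le> 3 * M"
    "empirical_ot n \<omega> = discrete_dual n \<epsilon> (sample_cost \<omega>) f g"
    by (rule empirical_potentials[OF assms]) blast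
  have avg: "\<bar>(\<Sum>i<n. u i) / n\<bar> \<le> D" if "\<forall>i<n. \<bar>u i\<bar> \<le> D" for u :: "nat \<Rightarrow> real" and D
  proof -
    have "\<bar>\<Sum>i<n. u i\<bar> \<le> (\<Sum>i<n. D)"
      using that by (intro order_trans[OF sum_abs] sum_mono) auto
    then show ?thesis using \<open>0 < n\<close> by (simp add: abs_divide field_simps)
  qed
  show ?thesis
  proof -
    have "\<forall>i<n. \<bar>f i\<bar> \<le> 2 * M" "\<forall>j<n. \<bar>g j\<bar> \<le> 3 * M"
      using fg(2,3) by blast+
    from this[THEN avg] show ?thesis
      unfolding fg(4) discrete_dual_potentials[OF fg(1) assms(1)] by linarith
  qed
qed

text \<open>
  Rounding the coordinates of the maximizer up by less than \<open>\<delta>\<close> does not decrease the linear part of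
  the functional and multiplies the exponential sum by at most \<open>exp (2 \<delta> / \<epsilon>)\<close>.
\<close>
lemma discrete_dual_rational_approx:
  assumes dp: "discrete_potentials n \<epsilon> C f g" and n: "0 < n" and a: "a < discrete_dual n \<epsilon> C f g"
  shows "\<exists>(fs :: rat list) (gs :: rat list).
    a < discrete_dual n \<epsilon> C (\<lambda>i. of_rat (fs ! i)) (\<lambda>j. of_rat (gs ! j))"
proof -
  define t where "t = discrete_dual n \<epsilon> C f g - a"
  \<comment> \<open>This \<open>\<delta>\<close> makes the loss in the exponential part equal to half of the slack \<open>t\<close>.\<close>
  define \<delta> where "\<delta> = \<epsilon> / 2 * ln (1 + t / (2 * \<epsilon>))"
  have t: "0 < t" using a by (simp add: t_def)
  have \<delta>: "0 < \<delta>" "exp (2 * \<delta> / \<epsilon>) = 1 + t / (2 * \<epsilon>)"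
    using \<epsilon>_pos t by (auto simp: \<delta>_def add_pos_pos)
  have "\<exists>r :: rat. u < of_rat r \<and> of_rat r < u + \<delta>" for u :: real
    using of_rat_dense[of u "u + \<delta>"] \<delta>(1) by auto
  then obtain q :: "real \<Rightarrow> rat" where q: "\<And>u. u < of_rat (q u)" "\<And>u. of_rat (q u) < u + \<delta>"
    by metis
  let ?f = "\<lambda>i. of_rat (map (\<lambda>i. q (f i)) [0..<n] ! i) :: real"
  let ?g = "\<lambda>j. of_rat (map (\<lambda>j. q (g j)) [0..<n] ! j) :: real"
  have f: "f i < ?f i" "?f i < f i + \<delta>" and g: "g i < ?g i" "?g i < g i + \<delta>" if "i < n" for i
    using q that by auto
  have "(\<Sum>i<n. \<Sum>j<n. exp ((?f i + ?g j - C i j) / \<epsilon>))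
      \<le> (\<Sum>i<n. \<Sum>j<n. exp (2 * \<delta> / \<epsilon>) * exp ((f i + g j - C i j) / \<epsilon>))"
  proof (intro sum_mono)
    fix i j assume ij: "i \<in> {..<n}" "j \<in> {..<n}"
    then have "?f i + ?g j - C i j \<le> 2 * \<delta> + (f i + g j - C i j)"
      using f[of i] g[of j] by auto
    then have "(?f i + ?g j - C i j) / \<epsilon> \<le> 2 * \<delta> / \<epsilon> + (f i + g j - C i j) / \<epsilon>"
      using \<epsilon>_pos unfolding add_divide_distrib[symmetric] by (intro divide_right_mono) auto
    then show "exp ((?f i + ?g j - C i j) / \<epsilon>) \<le> exp (2 * \<delta> / \<epsilon>) * exp ((f i + g j - C i j) / \<epsilon>)"
      unfolding exp_add[symmetric] by simp
  qed
  also have "\<dots> = exp (2 * \<delta> / \<epsilon>) * (real n)\<^sup>2"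
    using dp by (simp add: discrete_potentials_def power2_eq_square flip: sum_distrib_left)
  finally have "(\<Sum>i<n. \<Sum>j<n. exp ((?f i + ?g j - C i j) / \<epsilon>)) / (real n)\<^sup>2 \<le> exp (2 * \<delta> / \<epsilon>)"
    using n by (simp add: field_simps)
  then have "\<epsilon> * ((\<Sum>i<n. \<Sum>j<n. exp ((?f i + ?g j - C i j) / \<epsilon>)) / (real n)\<^sup>2 - 1) \<le> \<epsilon> * (t / (2 * \<epsilon>))"
    using \<epsilon>_pos \<delta>(2) by (intro mult_left_mono) auto
  also have "\<dots> = t / 2" using \<epsilon>_pos by simp
  finally have "\<epsilon> * ((\<Sum>i<n. \<Sum>j<n. exp ((?f i + ?g j - C i j) / \<epsilon>)) / (real n)\<^sup>2 - 1) \<le> t / 2" .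
  moreover have "(\<Sum>i<n. f i) / n \<le> (\<Sum>i<n. ?f i) / n" "(\<Sum>j<n. g j) / n \<le> (\<Sum>j<n. ?g j) / n"
    using f g by (intro divide_right_mono sum_mono; force)+
  moreover have "(\<Sum>i<n. f i) / n + (\<Sum>j<n. g j) / n = a + t"
    using discrete_dual_potentials[OF dp n] by (simp add: t_def)
  ultimately have "a < discrete_dual n \<epsilon> C ?f ?g"
    using t unfolding discrete_dual_def by linarith
  then show ?thesis by blast
qed

text \<open>
  The potentials of the empirical problem come from an existence statement, so they give no hold on
  how the cost depends on the sample. But the cost is the supremum of the dual functional over
  rational vectors, a countable family of measurable functions of the sample.
\<close>
lemma measurable_empirical_ot:
  assumes n: "0 < n"
  shows "empirical_ot n \<in> borel_measurable (samples n \<alpha> \<beta>)"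
proof -
  have cost: "(\<lambda>\<omega>. sample_cost \<omega> i j) \<in> borel_measurable (samples n \<alpha> \<beta>)" if "i < n" "j < n" for i j
  proof -
    have [measurable]: "(\<lambda>\<omega>. \<omega> i) \<in> measurable (samples n \<alpha> \<beta>) (\<alpha> \<Otimes>\<^sub>M \<beta>)"
      "(\<lambda>\<omega>. \<omega> j) \<in> measurable (samples n \<alpha> \<beta>) (\<alpha> \<Otimes>\<^sub>M \<beta>)"
      using that by (auto simp: samples_def intro!: measurable_component_singleton)
    have "(\<lambda>\<omega>. (fst (\<omega> i), snd (\<omega> j))) \<in> measurable (samples n \<alpha> \<beta>) (\<alpha> \<Otimes>\<^sub>M \<beta>)"
      by measurable
    from measurable_compose[OF this measurable_cost] show ?thesis by simp
  qed
  have weight: "(\<lambda>\<omega>. exp ((f i + g j - sample_cost \<omega> i j) / \<epsilon>)) \<in> borel_measurable (samples n \<alpha> \<beta>)"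
    if "i < n" "j < n" for i j and f g :: "nat \<Rightarrow> real"
    using cost[OF that] by measurable
  have dual: "(\<lambda>\<omega>. discrete_dual n \<epsilon> (sample_cost \<omega>) f g) \<in> borel_measurable (samples n \<alpha> \<beta>)" for f g
    unfolding discrete_dual_def
    by (intro borel_measurable_diff borel_measurable_const borel_measurable_times borel_measurable_divide
        borel_measurable_sum weight) auto
  have "{\<omega> \<in> space (samples n \<alpha> \<beta>). a < empirical_ot n \<omega>}
      = (\<Union>fs :: rat list. \<Union>gs :: rat list. {\<omega> \<in> space (samples n \<alpha> \<beta>).
          a < discrete_dual n \<epsilon> (sample_cost \<omega>) (\<lambda>i. of_rat (fs ! i)) (\<lambda>j. of_rat (gs ! j))})" for a
  proof -
    have "a < empirical_ot n \<omega> \<longleftrightarrow> (\<exists>(fs :: rat list) (gs :: rat list).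
        a < discrete_dual n \<epsilon> (sample_cost \<omega>) (\<lambda>i. of_rat (fs ! i)) (\<lambda>j. of_rat (gs ! j)))"
      if \<omega>: "\<omega> \<in> space (samples n \<alpha> \<beta>)" for \<omega>
    proof -
      obtain f g where fg: "discrete_potentials n \<epsilon> (sample_cost \<omega>) f g"
        "empirical_ot n \<omega> = discrete_dual n \<epsilon> (sample_cost \<omega>) f g"
        by (rule empirical_potentials[OF n \<omega>]) blast
      show ?thesis
        unfolding fg(2)
        using discrete_dual_rational_approx[OF fg(1) n, of a] discrete_dual_maximal[OF fg(1) n \<epsilon>_pos]
        by (meson less_le_trans)
    qed
    then show ?thesis by blast
  qed
  moreover have "(\<Union>fs :: rat list. \<Union>gs :: rat list. {\<omega> \<in> space (samples n \<alpha> \<beta>).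
          a < discrete_dual n \<epsilon> (sample_cost \<omega>) (\<lambda>i. of_rat (fs ! i)) (\<lambda>j. of_rat (gs ! j))})
      \<in> sets (samples n \<alpha> \<beta>)" for a
    using dual by (intro sets.countable_UN'' countableI_type borel_measurable_less) auto
  ultimately show ?thesis
    by (simp add: borel_measurable_iff_greater)
qed

end

section \<open>The sampling error\<close>

lemma abs_exp_minus_one_le:
  fixes l P :: real
  assumes "exp l \<le> P" "1 \<le> P"
  shows "\<bar>exp l - 1\<bar> \<le> \<bar>l\<bar> * P"
proof (cases "0 \<le> l")
  case True
  have "exp l * (1 - l) \<le> exp l * exp (- l)"
    using exp_ge_add_one_self[of "- l"] by (intro mult_left_mono) auto
  then have "exp l - 1 \<le> l * exp l" by (simp add: exp_minus algebra_simps)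
  also have "\<dots> \<le> l * P" using True assms(1) by (intro mult_left_mono) auto
  finally show ?thesis using True by simp
next
  case False
  have "1 - exp l \<le> - l" using exp_ge_add_one_self[of l] by linarith
  also have "\<dots> \<le> - l * P" using False assms(2) by (simp add: mult_le_cancel_left1)
  finally show ?thesis using False by simp
qed

context entropic_potentials
begin

abbreviation plan_density :: "'a \<Rightarrow> 'b \<Rightarrow> real" where
  "plan_density x y \<equiv> exp ((f x + g y - c (x, y)) / \<epsilon>)"

lemma integrable_plan_density:
  shows "x \<in> space \<alpha> \<Longrightarrow> integrable \<beta> (\<lambda>y. plan_density x y)"
    and "y \<in> space \<beta> \<Longrightarrow> integrable \<alpha> (\<lambda>x. plan_density x y)"
  using first_marginal second_marginal not_integrable_integral_eq by fastforce+

text \<open>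
  A best response is a soft minimum of \<open>c (x, \<cdot>) - g\<close> and inherits the oscillation of \<open>c\<close> in \<open>x\<close>.
\<close>
lemma f_oscillation:
  assumes x: "x \<in> space \<alpha>" "x' \<in> space \<alpha>"
    and D: "\<And>y. y \<in> space \<beta> \<Longrightarrow> c (x, y) - c (x', y) \<le> D"
  shows "f x - f x' \<le> D"
proof -
  have "exp ((f x - f x' - D) / \<epsilon>) = (\<integral>y. exp ((f x - f x' - D) / \<epsilon>) * plan_density x' y \<partial>\<beta>)"
    using first_marginal[OF x(2)] by simp
  also have "\<dots> \<le> (\<integral>y. plan_density x y \<partial>\<beta>)"
  proof (intro integral_mono)
    fix y assume "y \<in> space \<beta>"
    then have "f x - f x' - D + (f x' + g y - c (x', y)) \<le> f x + g y - c (x, y)"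
      using D[of y] by simp
    then have "(f x - f x' - D) / \<epsilon> + (f x' + g y - c (x', y)) / \<epsilon> \<le> (f x + g y - c (x, y)) / \<epsilon>"
      using \<epsilon>_pos unfolding add_divide_distrib[symmetric] by (intro divide_right_mono) auto
    then show "exp ((f x - f x' - D) / \<epsilon>) * plan_density x' y \<le> plan_density x y"
      unfolding exp_add[symmetric] by simp
  qed (use integrable_plan_density(1) x in auto)
  also have "\<dots> = 1" by (rule first_marginal[OF x(1)])
  finally have "(f x - f x' - D) / \<epsilon> \<le> 0" by simp
  then show ?thesis using \<epsilon>_pos by (simp add: divide_le_0_iff)
qed

text \<open>
  Both \<open>f\<close> and \<open>c (\<cdot>, y)\<close> oscillate by at most \<open>D\<close>, so the density varies in \<open>x\<close> at most by the factor
  \<open>exp (2 D / \<epsilon>)\<close>; being one on average over \<open>x\<close>, it cannot exceed that factor.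
\<close>
lemma plan_density_bound:
  assumes osc: "\<And>x x' y. x \<in> space \<alpha> \<Longrightarrow> x' \<in> space \<alpha> \<Longrightarrow> y \<in> space \<beta> \<Longrightarrow> c (x, y) - c (x', y) \<le> D"
    and x: "x \<in> space \<alpha>" and y: "y \<in> space \<beta>"
  shows "plan_density x y \<le> exp (2 * D / \<epsilon>)"
proof -
  have "(\<integral>x'. exp (- (2 * D / \<epsilon>)) * plan_density x y \<partial>\<alpha>) \<le> (\<integral>x'. plan_density x' y \<partial>\<alpha>)"
  proof (intro integral_mono)
    fix x' assume x': "x' \<in> space \<alpha>"
    have "f x - f x' \<le> D" using osc x x' by (intro f_oscillation) auto
    then have "- (2 * D) + (f x + g y - c (x, y)) \<le> f x' + g y - c (x', y)"
      using osc[OF x' x y] by simp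
    then have "- (2 * D) / \<epsilon> + (f x + g y - c (x, y)) / \<epsilon> \<le> (f x' + g y - c (x', y)) / \<epsilon>"
      using \<epsilon>_pos unfolding add_divide_distrib[symmetric] by (intro divide_right_mono) auto
    then show "exp (- (2 * D / \<epsilon>)) * plan_density x y \<le> plan_density x' y"
      unfolding exp_add[symmetric] by simp
  qed (use integrable_plan_density(2) y in auto)
  then have "exp (- (2 * D / \<epsilon>)) * plan_density x y \<le> 1"
    using second_marginal[OF y] by (simp add: M1.prob_space)
  then show ?thesis by (simp add: exp_minus field_simps)
qed

definition density_fluctuation :: "'a \<Rightarrow> 'b \<Rightarrow> real" where
  "density_fluctuation x y = plan_density x y - 1"

text \<open>
  The fluctuation enters the error with the factor \<open>\<epsilon>\<close>, for which the bound \<open>P\<close> is useless when \<open>\<epsilon>\<close>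
  is large. There the logarithm of the density is of order \<open>1 / \<epsilon>\<close>, which compensates the factor and
  yields a bound free of \<open>\<epsilon>\<close> apart from \<open>P\<close>.
\<close>
lemma density_fluctuation_bound:
  assumes P: "\<And>x y. x \<in> space \<alpha> \<Longrightarrow> y \<in> space \<beta> \<Longrightarrow> plan_density x y \<le> P" "1 \<le> P"
    and x: "x \<in> space \<alpha>" and y: "y \<in> space \<beta>"
  shows "\<bar>density_fluctuation x y\<bar> \<le> P" "\<epsilon> * \<bar>density_fluctuation x y\<bar> \<le> 6 * M * P"
proof -
  let ?l = "(f x + g y - c (x, y)) / \<epsilon>"
  have "0 < plan_density x y" by simp
  then show "\<bar>density_fluctuation x y\<bar> \<le> P"
    using P(1)[OF x y] P(2) unfolding density_fluctuation_def by linarith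
  have l: "\<epsilon> * \<bar>?l\<bar> \<le> 6 * M"
    using \<epsilon>_pos f_bound[OF x] g_bound[OF y] cost_bound[OF x y] by (simp add: abs_divide)
  have "\<bar>exp ?l - 1\<bar> \<le> \<bar>?l\<bar> * P"
    by (rule abs_exp_minus_one_le[OF P(1)[OF x y] P(2)])
  then have "\<epsilon> * \<bar>density_fluctuation x y\<bar> \<le> \<epsilon> * (\<bar>?l\<bar> * P)"
    unfolding density_fluctuation_def using \<epsilon>_pos by (intro mult_left_mono) auto
  also have "\<dots> \<le> 6 * M * P"
    using mult_right_mono[OF l, of P] P(2) by (simp add: mult.assoc)
  finally show "\<epsilon> * \<bar>density_fluctuation x y\<bar> \<le> 6 * M * P" .
qed

definition row_average :: "nat \<Rightarrow> nat \<Rightarrow> (nat \<Rightarrow> 'a \<times> 'b) \<Rightarrow> real" where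
  "row_average n i \<omega> = (\<Sum>j<n. density_fluctuation (fst (\<omega> i)) (snd (\<omega> j))) / n"

definition column_average :: "nat \<Rightarrow> nat \<Rightarrow> (nat \<Rightarrow> 'a \<times> 'b) \<Rightarrow> real" where
  "column_average n j \<omega> = (\<Sum>i<n. density_fluctuation (fst (\<omega> i)) (snd (\<omega> j))) / n"

definition f_average :: "nat \<Rightarrow> (nat \<Rightarrow> 'a \<times> 'b) \<Rightarrow> real" where
  "f_average n \<omega> = (\<Sum>i<n. f (fst (\<omega> i)) - (\<integral>x. f x \<partial>\<alpha>)) / n"

definition g_average :: "nat \<Rightarrow> (nat \<Rightarrow> 'a \<times> 'b) \<Rightarrow> real" where
  "g_average n \<omega> = (\<Sum>j<n. g (snd (\<omega> j)) - (\<integral>y. g y \<partial>\<beta>)) / n"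

text \<open>
  The value of the empirical dual functional at the population potentials is the intermediate point:
  its distance to the empirical cost is \<open>discrete_dual_gap\<close>, its distance to the population cost
  consists of averages of centered terms.
\<close>
lemma sampling_error_le_averages:
  assumes n: "0 < n" and \<omega>: "\<omega> \<in> space (samples n \<alpha> \<beta>)"
  shows "sampling_error c \<epsilon> \<alpha> \<beta> n \<omega> \<le> \<bar>f_average n \<omega>\<bar> + \<bar>g_average n \<omega>\<bar>
      + (\<Sum>i<n. \<epsilon> * \<bar>row_average n i \<omega>\<bar> + 4 * M * \<bar>row_average n i \<omega>\<bar> + 6 * M * \<bar>column_average n i \<omega>\<bar>) / n"
proof -
  obtain F G where FG: "discrete_potentials n \<epsilon> (sample_cost \<omega>) F G"
    "\<And>i. i < n \<Longrightarrow> \<bar>F i\<bar> \<le> 2 * M" "\<And>j. j < n \<Longrightarrow> \<bar>G j\<bar> \<le> 3 * M"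
    "empirical_ot n \<omega> = discrete_dual n \<epsilon> (sample_cost \<omega>) F G"
    by (rule empirical_potentials[OF n \<omega>]) blast
  let ?f = "\<lambda>i. f (fst (\<omega> i))" and ?g = "\<lambda>j. g (snd (\<omega> j))"
  let ?D = "discrete_dual n \<epsilon> (sample_cost \<omega>) ?f ?g"
  have sp: "fst (\<omega> i) \<in> space \<alpha>" "snd (\<omega> i) \<in> space \<beta>" if "i < n" for i
    using samples_space[OF \<omega> that] by auto
  have gapF: "\<bar>F i - ?f i\<bar> \<le> 4 * M" if "i < n" for i
    using FG(2)[OF that] f_bound[OF sp(1)[OF that]] by linarith
  have gapG: "\<bar>G i - ?g i\<bar> \<le> 6 * M" if "i < n" for i
    using FG(3)[OF that] g_bound[OF sp(2)[OF that]] by linarith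
  have gap: "\<bar>empirical_ot n \<omega> - ?D\<bar> \<le> 4 * M * ((\<Sum>i<n. \<bar>row_average n i \<omega>\<bar>) / n)
      + 6 * M * ((\<Sum>j<n. \<bar>column_average n j \<omega>\<bar>) / n)"
    unfolding FG(4) row_average_def column_average_def density_fluctuation_def
    by (rule discrete_dual_gap[OF FG(1) n \<epsilon>_pos]) (rule gapF gapG; assumption)+
  have avg: "(\<Sum>i<n. \<Sum>j<n. plan_density (fst (\<omega> i)) (snd (\<omega> j))) / (real n)\<^sup>2 - 1
      = (\<Sum>i<n. row_average n i \<omega>) / n"
    using n by (simp add: row_average_def density_fluctuation_def sum_subtractf diff_divide_distrib
        power2_eq_square flip: sum_divide_distrib)
  have "entropic_ot c \<epsilon> \<alpha> \<beta> - ?D = \<epsilon> * ((\<Sum>i<n. row_average n i \<omega>) / n) - f_average n \<omega> - g_average n \<omega>"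
    unfolding entropic_ot_eq_dual discrete_dual_def avg f_average_def g_average_def
    using n by (simp add: sum_subtractf diff_divide_distrib)
  moreover have "\<bar>\<epsilon> * ((\<Sum>i<n. row_average n i \<omega>) / n)\<bar> \<le> \<epsilon> * ((\<Sum>i<n. \<bar>row_average n i \<omega>\<bar>) / n)"
    using \<epsilon>_pos n by (simp add: abs_mult abs_divide divide_right_mono)
  ultimately have "sampling_error c \<epsilon> \<alpha> \<beta> n \<omega> \<le> \<bar>f_average n \<omega>\<bar> + \<bar>g_average n \<omega>\<bar>
      + (\<epsilon> * ((\<Sum>i<n. \<bar>row_average n i \<omega>\<bar>) / n) + 4 * M * ((\<Sum>i<n. \<bar>row_average n i \<omega>\<bar>) / n)
      + 6 * M * ((\<Sum>j<n. \<bar>column_average n j \<omega>\<bar>) / n))"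
    using gap unfolding sampling_error_def by linarith
  also have "\<epsilon> * ((\<Sum>i<n. \<bar>row_average n i \<omega>\<bar>) / n) + 4 * M * ((\<Sum>i<n. \<bar>row_average n i \<omega>\<bar>) / n)
      + 6 * M * ((\<Sum>j<n. \<bar>column_average n j \<omega>\<bar>) / n)
      = (\<Sum>i<n. \<epsilon> * \<bar>row_average n i \<omega>\<bar> + 4 * M * \<bar>row_average n i \<omega>\<bar> + 6 * M * \<bar>column_average n i \<omega>\<bar>) / n"
    by (simp add: sum.distrib sum_distrib_left add_divide_distrib)
  finally show ?thesis .
qed

lemma prob_space_pair: "prob_space (\<alpha> \<Otimes>\<^sub>M \<beta>)"
  by unfold_locales

text \<open>
  Instances of \<open>centered_average_bound\<close> for the pairs \<open>(X\<^sub>i, Y\<^sub>i)\<close>: a row average pairs the first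
  component of a fixed pair with the second components of all pairs, a column average does the
  opposite, and the averages of \<open>f\<close> and \<open>g\<close> ignore the fixed pair.
\<close>
lemma average_bounds:
  assumes P: "\<And>x y. x \<in> space \<alpha> \<Longrightarrow> y \<in> space \<beta> \<Longrightarrow> plan_density x y \<le> P" "1 \<le> P" and i: "i < n"
  shows "integrable (samples n \<alpha> \<beta>) (f_average n)"
    "(\<integral>\<omega>. \<bar>f_average n \<omega>\<bar> \<partial>samples n \<alpha> \<beta>) \<le> 4 * M / sqrt n"
    "integrable (samples n \<alpha> \<beta>) (g_average n)"
    "(\<integral>\<omega>. \<bar>g_average n \<omega>\<bar> \<partial>samples n \<alpha> \<beta>) \<le> 6 * M / sqrt n"
    "integrable (samples n \<alpha> \<beta>) (row_average n i)"
    "(\<integral>\<omega>. \<epsilon> * \<bar>row_average n i \<omega>\<bar> \<partial>samples n \<alpha> \<beta>) \<le> 6 * M * P / sqrt n"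
    "(\<integral>\<omega>. \<bar>row_average n i \<omega>\<bar> \<partial>samples n \<alpha> \<beta>) \<le> P / sqrt n"
    "integrable (samples n \<alpha> \<beta>) (column_average n i)"
    "(\<integral>\<omega>. \<bar>column_average n i \<omega>\<bar> \<partial>samples n \<alpha> \<beta>) \<le> P / sqrt n"
proof -
  let ?\<mu> = "\<alpha> \<Otimes>\<^sub>M \<beta>"
  have [measurable]: "(\<lambda>z. density_fluctuation (fst z) (snd z)) \<in> borel_measurable ?\<mu>"
    unfolding density_fluctuation_def by simp
  have m: "(\<lambda>(z, w). density_fluctuation (fst z) (snd w)) \<in> borel_measurable (?\<mu> \<Otimes>\<^sub>M ?\<mu>)"
    "(\<lambda>(w, z). density_fluctuation (fst z) (snd w)) \<in> borel_measurable (?\<mu> \<Otimes>\<^sub>M ?\<mu>)"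
  proof -
    have "(\<lambda>(z, w). (fst z, snd w)) \<in> measurable (?\<mu> \<Otimes>\<^sub>M ?\<mu>) ?\<mu>" by measurable
    from measurable_compose[OF this \<open>(\<lambda>z. density_fluctuation (fst z) (snd z)) \<in> borel_measurable ?\<mu>\<close>]
    show "(\<lambda>(z, w). density_fluctuation (fst z) (snd w)) \<in> borel_measurable (?\<mu> \<Otimes>\<^sub>M ?\<mu>)"
      by (simp add: case_prod_beta')
    have "(\<lambda>(w, z). (fst z, snd w)) \<in> measurable (?\<mu> \<Otimes>\<^sub>M ?\<mu>) ?\<mu>" by measurable
    from measurable_compose[OF this \<open>(\<lambda>z. density_fluctuation (fst z) (snd z)) \<in> borel_measurable ?\<mu>\<close>]
    show "(\<lambda>(w, z). density_fluctuation (fst z) (snd w)) \<in> borel_measurable (?\<mu> \<Otimes>\<^sub>M ?\<mu>)"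
      by (simp add: case_prod_beta')
  qed
  have sp: "z \<in> space ?\<mu> \<Longrightarrow> fst z \<in> space \<alpha> \<and> snd z \<in> space \<beta>" for z
    by (auto simp: space_pair_measure)
  have int_snd: "(\<integral>w. h (snd w) \<partial>?\<mu>) = (\<integral>y. h y \<partial>\<beta>)" if [measurable]: "h \<in> borel_measurable \<beta>" for h :: "'b \<Rightarrow> real"
  proof -
    have "distr ?\<mu> \<beta> snd = distr (distr (\<beta> \<Otimes>\<^sub>M \<alpha>) ?\<mu> (\<lambda>(x, y). (y, x))) \<beta> snd"
      by (subst distr_pair_swap) (rule refl)
    also have "\<dots> = distr (\<beta> \<Otimes>\<^sub>M \<alpha>) \<beta> fst"
      by (subst distr_distr) (auto simp: comp_def case_prod_beta')
    also have "\<dots> = \<beta>" by (rule M1.distr_pair_fst)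
    finally show ?thesis
      using integral_distr[of snd ?\<mu> \<beta> h] by simp
  qed
  have int_fst: "(\<integral>w. h (fst w) \<partial>?\<mu>) = (\<integral>x. h x \<partial>\<alpha>)" if [measurable]: "h \<in> borel_measurable \<alpha>" for h :: "'a \<Rightarrow> real"
    using integral_distr[of fst ?\<mu> \<alpha> h] M2.distr_pair_fst[of \<alpha>] by simp
  have row0: "(\<integral>w. density_fluctuation (fst z) (snd w) \<partial>?\<mu>) = 0" if z: "z \<in> space ?\<mu>" for z
  proof -
    have [measurable]: "fst z \<in> space \<alpha>" using sp[OF z] by simp
    have [measurable]: "(\<lambda>y. density_fluctuation (fst z) y) \<in> borel_measurable \<beta>"
      unfolding density_fluctuation_def by measurable
    show ?thesis
      using integrable_plan_density(1)[of "fst z"] first_marginal[of "fst z"] sp[OF z]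
      by (subst int_snd) (auto simp: density_fluctuation_def[abs_def] M2.prob_space)
  qed
  have col0: "(\<integral>w. density_fluctuation (fst w) (snd z) \<partial>?\<mu>) = 0" if z: "z \<in> space ?\<mu>" for z
  proof -
    have [measurable]: "snd z \<in> space \<beta>" using sp[OF z] by simp
    have [measurable]: "(\<lambda>x. density_fluctuation x (snd z)) \<in> borel_measurable \<alpha>"
      unfolding density_fluctuation_def by measurable
    show ?thesis
      using integrable_plan_density(2)[of "snd z"] second_marginal[of "snd z"] sp[OF z]
      by (subst int_fst[of "\<lambda>x. density_fluctuation x (snd z)"]) (auto simp: density_fluctuation_def M1.prob_space)
  qed
  have fi: "integrable \<alpha> f"
    using f_bound by (intro M1.integrable_const_bound[where B="2 * M"]) auto
  have gi: "integrable \<beta> g"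
    using g_bound by (intro M2.integrable_const_bound[where B="3 * M"]) auto
  have mean_bound: "\<bar>\<integral>x. f x \<partial>\<alpha>\<bar> \<le> 2 * M" "\<bar>\<integral>y. g y \<partial>\<beta>\<bar> \<le> 3 * M"
  proof -
    have "\<bar>\<integral>x. f x \<partial>\<alpha>\<bar> \<le> (\<integral>x. \<bar>f x\<bar> \<partial>\<alpha>)" by (rule integral_abs_bound)
    also have "\<dots> \<le> (\<integral>x. 2 * M \<partial>\<alpha>)" using f_bound fi by (intro integral_mono) auto
    finally show "\<bar>\<integral>x. f x \<partial>\<alpha>\<bar> \<le> 2 * M" by (simp add: M1.prob_space)
    have "\<bar>\<integral>y. g y \<partial>\<beta>\<bar> \<le> (\<integral>y. \<bar>g y\<bar> \<partial>\<beta>)" by (rule integral_abs_bound)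
    also have "\<dots> \<le> (\<integral>y. 3 * M \<partial>\<beta>)" using g_bound gi by (intro integral_mono) auto
    finally show "\<bar>\<integral>y. g y \<partial>\<beta>\<bar> \<le> 3 * M" by (simp add: M2.prob_space)
  qed
  have "\<bar>f (fst w) - (\<integral>x. f x \<partial>\<alpha>)\<bar> \<le> 4 * M" "\<bar>g (snd w) - (\<integral>y. g y \<partial>\<beta>)\<bar> \<le> 6 * M"
    if "w \<in> space ?\<mu>" for w
    using f_bound[of "fst w"] g_bound[of "snd w"] sp[OF that] mean_bound by linarith+
  note fg_bound = this
  have "(\<integral>w. f (fst w) - (\<integral>x. f x \<partial>\<alpha>) \<partial>?\<mu>) = 0"
    using fi by (subst int_fst[of "\<lambda>x. f x - (\<integral>x. f x \<partial>\<alpha>)"]) (auto simp: M1.prob_space)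
  note f0 = this
  have "(\<integral>w. g (snd w) - (\<integral>y. g y \<partial>\<beta>) \<partial>?\<mu>) = 0"
    using gi by (subst int_snd[of "\<lambda>y. g y - (\<integral>y. g y \<partial>\<beta>)"]) (auto simp: M2.prob_space)
  note g0 = this
  note lln = centered_average_bound[OF prob_space_pair _ _ _ i, folded samples_def]
  show "integrable (samples n \<alpha> \<beta>) (f_average n)" "(\<integral>\<omega>. \<bar>f_average n \<omega>\<bar> \<partial>samples n \<alpha> \<beta>) \<le> 4 * M / sqrt n"
    unfolding f_average_def[abs_def] using fg_bound(1) f0
    by (intro lln[where h="\<lambda>z w. f (fst w) - (\<integral>x. f x \<partial>\<alpha>)" and B="4 * M"]; simp)+
  show "integrable (samples n \<alpha> \<beta>) (g_average n)" "(\<integral>\<omega>. \<bar>g_average n \<omega>\<bar> \<partial>samples n \<alpha> \<beta>) \<le> 6 * M / sqrt n"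
    unfolding g_average_def[abs_def] using fg_bound(2) g0
    by (intro lln[where h="\<lambda>z w. g (snd w) - (\<integral>y. g y \<partial>\<beta>)" and B="6 * M"]; simp)+
  note fl = density_fluctuation_bound[OF P]
  have row: "integrable (samples n \<alpha> \<beta>) (row_average n i)"
      "(\<integral>\<omega>. \<bar>row_average n i \<omega>\<bar> \<partial>samples n \<alpha> \<beta>) \<le> B / sqrt n"
    if "\<And>x y. x \<in> space \<alpha> \<Longrightarrow> y \<in> space \<beta> \<Longrightarrow> \<bar>density_fluctuation x y\<bar> \<le> B" for B
    unfolding row_average_def[abs_def] using that sp row0 m
    by (intro lln[where h="\<lambda>z w. density_fluctuation (fst z) (snd w)" and B=B]; simp)+
  show "integrable (samples n \<alpha> \<beta>) (row_average n i)"
      "(\<integral>\<omega>. \<bar>row_average n i \<omega>\<bar> \<partial>samples n \<alpha> \<beta>) \<le> P / sqrt n"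
    by (rule row[of P], rule fl(1), assumption+)+
  have "(\<integral>\<omega>. \<bar>row_average n i \<omega>\<bar> \<partial>samples n \<alpha> \<beta>) \<le> (6 * M * P / \<epsilon>) / sqrt n"
    using fl(2) \<epsilon>_pos by (intro row(2)) (simp add: field_simps)
  then have "\<epsilon> * (\<integral>\<omega>. \<bar>row_average n i \<omega>\<bar> \<partial>samples n \<alpha> \<beta>) \<le> \<epsilon> * ((6 * M * P / \<epsilon>) / sqrt n)"
    using \<epsilon>_pos by (intro mult_left_mono) auto
  then show "(\<integral>\<omega>. \<epsilon> * \<bar>row_average n i \<omega>\<bar> \<partial>samples n \<alpha> \<beta>) \<le> 6 * M * P / sqrt n"
    using \<epsilon>_pos by simp
  show "integrable (samples n \<alpha> \<beta>) (column_average n i)"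
      "(\<integral>\<omega>. \<bar>column_average n i \<omega>\<bar> \<partial>samples n \<alpha> \<beta>) \<le> P / sqrt n"
    unfolding column_average_def[abs_def] using fl(1) sp col0 m
    by (intro lln[where h="\<lambda>w z. density_fluctuation (fst z) (snd w)" and B=P]; simp)+
qed

theorem expected_error_bound:
  assumes osc: "\<And>x x' y. x \<in> space \<alpha> \<Longrightarrow> x' \<in> space \<alpha> \<Longrightarrow> y \<in> space \<beta> \<Longrightarrow> c (x, y) - c (x', y) \<le> D"
    and D: "0 \<le> D" and n: "0 < n"
  shows "integrable (samples n \<alpha> \<beta>) (sampling_error c \<epsilon> \<alpha> \<beta> n)"
    "expected_error c \<epsilon> \<alpha> \<beta> n \<le> 26 * M * exp (2 * D / \<epsilon>) / sqrt n"
proof -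
  let ?\<Omega> = "samples n \<alpha> \<beta>" and ?P = "exp (2 * D / \<epsilon>)"
  interpret \<Omega>: prob_space ?\<Omega>
    unfolding samples_def by (intro prob_space_PiM prob_space_pair)
  have P: "plan_density x y \<le> ?P" if "x \<in> space \<alpha>" "y \<in> space \<beta>" for x y
    using osc that by (intro plan_density_bound)
  have P1: "1 \<le> ?P" using D \<epsilon>_pos by simp
  note avg = average_bounds[of ?P, OF P P1]
  have "sampling_error c \<epsilon> \<alpha> \<beta> n \<omega> \<le> \<bar>entropic_ot c \<epsilon> \<alpha> \<beta>\<bar> + 5 * M" if "\<omega> \<in> space ?\<Omega>" for \<omega>
    using empirical_ot_bound[OF n that] unfolding sampling_error_def by linarith
  moreover have "sampling_error c \<epsilon> \<alpha> \<beta> n \<in> borel_measurable ?\<Omega>"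
    unfolding sampling_error_def[abs_def] using measurable_empirical_ot[OF n] by measurable
  ultimately show int: "integrable ?\<Omega> (sampling_error c \<epsilon> \<alpha> \<beta> n)"
    by (intro \<Omega>.integrable_const_bound[where B="\<bar>entropic_ot c \<epsilon> \<alpha> \<beta>\<bar> + 5 * M"])
       (auto simp: sampling_error_def)
  let ?t = "\<lambda>i \<omega>. \<epsilon> * \<bar>row_average n i \<omega>\<bar> + 4 * M * \<bar>row_average n i \<omega>\<bar> + 6 * M * \<bar>column_average n i \<omega>\<bar>"
  have ti: "integrable ?\<Omega> (?t i)" if "i < n" for i
    using avg(5,8)[OF _ _ that] by simp
  have t: "(\<integral>\<omega>. ?t i \<omega> \<partial>?\<Omega>) \<le> 16 * M * ?P / sqrt n" if "i < n" for i
  proof -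
    have "(\<integral>\<omega>. ?t i \<omega> \<partial>?\<Omega>) = (\<integral>\<omega>. \<epsilon> * \<bar>row_average n i \<omega>\<bar> \<partial>?\<Omega>)
        + 4 * M * (\<integral>\<omega>. \<bar>row_average n i \<omega>\<bar> \<partial>?\<Omega>) + 6 * M * (\<integral>\<omega>. \<bar>column_average n i \<omega>\<bar> \<partial>?\<Omega>)"
      using avg(5,8)[OF _ _ that] by simp
    also have "\<dots> \<le> 6 * M * ?P / sqrt n + 4 * M * (?P / sqrt n) + 6 * M * (?P / sqrt n)"
      using avg(6,7,9)[OF _ _ that] M_nonneg by (intro add_mono mult_left_mono) auto
    finally show ?thesis by (simp add: field_simps)
  qed
  have sum_int: "integrable ?\<Omega> (\<lambda>\<omega>. \<Sum>i<n. ?t i \<omega>)"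
    by (rule Bochner_Integration.integrable_sum) (simp only: lessThan_iff ti)
  have "expected_error c \<epsilon> \<alpha> \<beta> n
      \<le> (\<integral>\<omega>. \<bar>f_average n \<omega>\<bar> + \<bar>g_average n \<omega>\<bar> + (\<Sum>i<n. ?t i \<omega>) / n \<partial>?\<Omega>)"
    unfolding expected_error_def
  proof (rule integral_mono[OF int])
    show "integrable ?\<Omega> (\<lambda>\<omega>. \<bar>f_average n \<omega>\<bar> + \<bar>g_average n \<omega>\<bar> + (\<Sum>i<n. ?t i \<omega>) / n)"
      by (intro Bochner_Integration.integrable_add integrable_abs Bochner_Integration.integrable_divide_zero
          sum_int avg(1)[OF _ _ n] avg(3)[OF _ _ n])
  qed (rule sampling_error_le_averages[OF n])
  also have "\<dots> = (\<integral>\<omega>. \<bar>f_average n \<omega>\<bar> \<partial>?\<Omega>) + (\<integral>\<omega>. \<bar>g_average n \<omega>\<bar> \<partial>?\<Omega>) + (\<Sum>i<n. \<integral>\<omega>. ?t i \<omega> \<partial>?\<Omega>) / n"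
  proof -
    have "(\<integral>\<omega>. (\<Sum>i<n. ?t i \<omega>) \<partial>?\<Omega>) = (\<Sum>i<n. \<integral>\<omega>. ?t i \<omega> \<partial>?\<Omega>)"
      by (rule Bochner_Integration.integral_sum) (simp only: lessThan_iff ti)
    moreover have "(\<integral>\<omega>. \<bar>f_average n \<omega>\<bar> + \<bar>g_average n \<omega>\<bar> + (\<Sum>i<n. ?t i \<omega>) / n \<partial>?\<Omega>)
        = (\<integral>\<omega>. \<bar>f_average n \<omega>\<bar> \<partial>?\<Omega>) + (\<integral>\<omega>. \<bar>g_average n \<omega>\<bar> \<partial>?\<Omega>) + (\<integral>\<omega>. (\<Sum>i<n. ?t i \<omega>) \<partial>?\<Omega>) / n"
      using integrable_abs[OF avg(1)[OF _ _ n]] integrable_abs[OF avg(3)[OF _ _ n]] sum_int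
      by (simp del: sum_int)
    ultimately show ?thesis by simp
  qed
  also have "\<dots> \<le> 4 * M / sqrt n + 6 * M / sqrt n + (\<Sum>i<n. 16 * M * ?P / sqrt n) / n"
    using avg(2,4)[OF _ _ n] t by (intro add_mono divide_right_mono sum_mono) auto
  also have "\<dots> = (10 * M + 16 * M * ?P) / sqrt n"
    using n by (simp add: add_divide_distrib)
  also have "\<dots> \<le> 26 * M * ?P / sqrt n"
    using mult_left_mono[OF P1, of "10 * M"] M_nonneg by (intro divide_right_mono) auto
  finally show "expected_error c \<epsilon> \<alpha> \<beta> n \<le> 26 * M * ?P / sqrt n" .
qed

end

section \<open>The Euclidean setting\<close>

lemma ot_setting_cost_bound:
  assumes "ot_setting X Y \<alpha> \<beta> c L" "z \<in> X \<times> Y"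
  shows "\<bar>c z\<bar> \<le> deriv_norm (X \<times> Y) c 0"
proof -
  have "bdd_above (deriv_values (X \<times> Y) c 0)"
    using assms(1) by (simp add: ot_setting_def)
  moreover have "\<bar>c z\<bar> \<in> deriv_values (X \<times> Y) c 0"
    using assms(2) by (force simp: deriv_values_def)
  ultimately show ?thesis
    unfolding deriv_norm_def by (rule cSup_upper[rotated])
qed

lemma prob_measure_on_space: "prob_measure_on X \<mu> \<Longrightarrow> space \<mu> = X"
  using sets_eq_imp_space_eq[of \<mu> "restrict_space borel X"]
  by (simp add: prob_measure_on_def space_restrict_space)

lemma prob_measure_on_borel:
  assumes "prob_measure_on X \<mu>" shows "(\<lambda>x. x) \<in> measurable \<mu> borel"
proof -
  have "sets \<mu> = sets (restrict_space borel X)"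
    using assms by (simp add: prob_measure_on_def)
  then show ?thesis
    using measurable_restrict_space1[OF measurable_ident_sets[OF refl]]
    by (subst measurable_cong_sets[OF _ refl])
qed

text \<open>
  Outside the neighbourhood \<open>U\<close> of \<open>X \<times> Y\<close> the function \<open>c\<close> is arbitrary, so it is cut off there
  before Borel measurability is invoked.
\<close>
lemma measurable_smooth_cost:
  fixes X Y :: "(real^'n) set"
  assumes "smooth_on (X \<times> Y) c" and \<alpha>: "prob_measure_on X \<alpha>" and \<beta>: "prob_measure_on Y \<beta>"
  shows "c \<in> borel_measurable (\<alpha> \<Otimes>\<^sub>M \<beta>)"
proof -
  obtain U where U: "open U" "X \<times> Y \<subseteq> U"
    and diff: "\<And>bs z. set bs \<subseteq> Basis \<Longrightarrow> z \<in> U \<Longrightarrow> partial_deriv bs c differentiable (at z)"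
    using assms(1) unfolding smooth_on_def by blast
  have "continuous_on U c"
    using diff[of "[]"] by (intro continuous_at_imp_continuous_on ballI differentiable_imp_continuous_within) simp
  then have ind: "(\<lambda>z. indicator U z *\<^sub>R c z) \<in> borel_measurable borel"
    using U(1) by (intro borel_measurable_continuous_on_indicator) auto
  have "(\<lambda>z. (fst z, snd z)) \<in> measurable (\<alpha> \<Otimes>\<^sub>M \<beta>) (borel \<Otimes>\<^sub>M borel)"
    by (intro measurable_Pair measurable_compose[OF measurable_fst prob_measure_on_borel[OF \<alpha>]]
        measurable_compose[OF measurable_snd prob_measure_on_borel[OF \<beta>]])
  then have "(\<lambda>z. z) \<in> measurable (\<alpha> \<Otimes>\<^sub>M \<beta>) borel"
    by (simp add: borel_prod)
  from measurable_compose[OF this ind]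
  have "(\<lambda>z. indicator U z *\<^sub>R c z) \<in> borel_measurable (\<alpha> \<Otimes>\<^sub>M \<beta>)" .
  moreover have "indicator U z *\<^sub>R c z = c z" if "z \<in> space (\<alpha> \<Otimes>\<^sub>M \<beta>)" for z
    using that U(2) prob_measure_on_space[OF \<alpha>] prob_measure_on_space[OF \<beta>]
    by (auto simp: space_pair_measure indicator_def)
  ultimately show ?thesis
    by (subst measurable_cong[where g="\<lambda>z. indicator U z *\<^sub>R c z"]) auto
qed

text \<open>
  The oscillation of \<open>c\<close> in the first variable is at most \<open>L\<close> times the diameter of \<open>X\<close>, because points
  that share their second component are as far apart as their first components.
\<close>
lemma ot_setting_error:
  fixes X Y :: "(real^'n) set"
  assumes setting: "ot_setting X Y \<alpha> \<beta> c L" and \<epsilon>: "0 < \<epsilon>" and n: "0 < n"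
  shows "integrable (samples n \<alpha> \<beta>) (sampling_error c \<epsilon> \<alpha> \<beta> n)"
    "expected_error c \<epsilon> \<alpha> \<beta> n
       \<le> 26 * deriv_norm (X \<times> Y) c 0 * exp (2 * (L * diameter X) / \<epsilon>) / sqrt n"
    "0 \<le> deriv_norm (X \<times> Y) c 0"
proof -
  have \<alpha>: "prob_measure_on X \<alpha>" and \<beta>: "prob_measure_on Y \<beta>" and "smooth_on (X \<times> Y) c"
    and lip: "L-lipschitz_on (X \<times> Y) c" and "bounded X"
    using setting by (auto simp: ot_setting_def)
  note sp = prob_measure_on_space[OF \<alpha>] prob_measure_on_space[OF \<beta>]
  let ?M = "deriv_norm (X \<times> Y) c 0"
  have M: "\<bar>c (x, y)\<bar> \<le> ?M" if "x \<in> X" "y \<in> Y" for x y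
    using ot_setting_cost_bound[OF setting] that by simp
  have prob: "prob_space \<alpha>" "prob_space \<beta>"
    using \<alpha> \<beta> by (auto simp: prob_measure_on_def)
  obtain f g where "entropic_potentials \<alpha> \<beta> c \<epsilon> ?M f g"
    by (rule entropic_potentials_exist[OF prob \<epsilon> measurable_smooth_cost[OF \<open>smooth_on (X \<times> Y) c\<close> \<alpha> \<beta>]])
      (use M sp in blast)+
  then interpret entropic_potentials \<alpha> \<beta> c \<epsilon> ?M f g .
  have L: "0 \<le> L" using lip by (rule lipschitz_on_nonneg)
  have osc: "c (x, y) - c (x', y) \<le> L * diameter X" if "x \<in> space \<alpha>" "x' \<in> space \<alpha>" "y \<in> space \<beta>" for x x' y
  proof -
    have "c (x, y) - c (x', y) \<le> dist (c (x, y)) (c (x', y))"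
      by (simp add: dist_real_def)
    also have "\<dots> \<le> L * dist (x, y) (x', y)"
      using that sp by (intro lipschitz_onD[OF lip]) auto
    also have "\<dots> \<le> L * diameter X"
      using L diameter_bounded_bound[OF \<open>bounded X\<close>] that sp by (intro mult_left_mono) (auto simp: dist_Pair_Pair)
    finally show ?thesis .
  qed
  have D: "0 \<le> L * diameter X"
    using L diameter_ge_0[OF \<open>bounded X\<close>] by simp
  show "integrable (samples n \<alpha> \<beta>) (sampling_error c \<epsilon> \<alpha> \<beta> n)"
    by (rule expected_error_bound(1)[OF _ D n]) (rule osc)
  show "expected_error c \<epsilon> \<alpha> \<beta> n \<le> 26 * ?M * exp (2 * (L * diameter X) / \<epsilon>) / sqrt n"
    by (rule expected_error_bound(2)[OF _ D n]) (rule osc)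
  show "0 \<le> ?M" by (rule M_nonneg)
qed

lemma deriv_norms_nth_0: "deriv_norms X Y c ! 0 = deriv_norm (X \<times> Y) c 0"
  by (simp add: deriv_norms_def del: upt_Suc)

lemma ot_setting_error_kappa:
  fixes X Y :: "(real^'n) set"
  assumes setting: "ot_setting X Y \<alpha> \<beta> c L" and \<epsilon>: "0 < \<epsilon>" and n: "0 < n" and A: "1 \<le> A"
  shows "expected_error c \<epsilon> \<alpha> \<beta> n
       \<le> 26 * deriv_norms X Y c ! 0 * (exp (kappa X Y c L / \<epsilon>) / sqrt n * A)"
proof -
  let ?M = "deriv_norm (X \<times> Y) c 0"
  note err = ot_setting_error[OF setting \<epsilon> n]
  have "exp (2 * (L * diameter X) / \<epsilon>) \<le> exp (kappa X Y c L / \<epsilon>)"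
    using err(3) \<epsilon> by (simp add: kappa_def divide_right_mono)
  then have "exp (2 * (L * diameter X) / \<epsilon>) / sqrt n \<le> exp (kappa X Y c L / \<epsilon>) / sqrt n * 1"
    by (simp add: divide_right_mono)
  also have "\<dots> \<le> exp (kappa X Y c L / \<epsilon>) / sqrt n * A"
    using A by (intro mult_left_mono) auto
  finally have "26 * ?M * (exp (2 * (L * diameter X) / \<epsilon>) / sqrt n) \<le> 26 * ?M * (exp (kappa X Y c L / \<epsilon>) / sqrt n * A)"
    using err(3) by (intro mult_left_mono) auto
  then show ?thesis
    using err(2) unfolding deriv_norms_nth_0 by simp
qed

theorem theorem3:
  shows "(\<exists>K :: real \<Rightarrow> real \<Rightarrow> real list \<Rightarrow> real.
      \<forall>(X :: (real^'n) set) Y \<alpha> \<beta> c L \<epsilon> n.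
        ot_setting X Y \<alpha> \<beta> c L \<longrightarrow> 0 < \<epsilon> \<longrightarrow> 0 < n \<longrightarrow>
        integrable (samples n \<alpha> \<beta>) (sampling_error c \<epsilon> \<alpha> \<beta> n) \<and>
        expected_error c \<epsilon> \<alpha> \<beta> n \<le>
          K (diameter X) (diameter Y) (deriv_norms X Y c) *
          (exp (kappa X Y c L / \<epsilon>) / sqrt (real n) * (1 + 1 / \<epsilon> ^ (CARD('n) div 2))))
    \<and> (\<exists>K :: real \<Rightarrow> real \<Rightarrow> real list \<Rightarrow> real.
      \<forall>dX dY M. \<forall>\<^sub>F \<epsilon> in at_right 0.
        \<forall>(X :: (real^'n) set) Y \<alpha> \<beta> c L n.
          ot_setting X Y \<alpha> \<beta> c L \<longrightarrow>
          diameter X = dX \<longrightarrow> diameter Y = dY \<longrightarrow> deriv_norms X Y c = M \<longrightarrow> 0 < n \<longrightarrow>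
          expected_error c \<epsilon> \<alpha> \<beta> n \<le>
            K dX dY M * (exp (kappa X Y c L / \<epsilon>) / (\<epsilon> ^ (CARD('n) div 2) * sqrt (real n))))
    \<and> (\<exists>K :: real \<Rightarrow> real \<Rightarrow> real list \<Rightarrow> real.
      \<forall>dX dY M L. \<forall>\<^sub>F \<epsilon> in at_top.
        \<forall>(X :: (real^'n) set) Y \<alpha> \<beta> c n.
          ot_setting X Y \<alpha> \<beta> c L \<longrightarrow>
          diameter X = dX \<longrightarrow> diameter Y = dY \<longrightarrow> deriv_norms X Y c = M \<longrightarrow> 0 < n \<longrightarrow>
          expected_error c \<epsilon> \<alpha> \<beta> n \<le> K dX dY M / sqrt (real n))"
proof (intro conjI)
  show "\<exists>K :: real \<Rightarrow> real \<Rightarrow> real list \<Rightarrow> real.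
      \<forall>(X :: (real^'n) set) Y \<alpha> \<beta> c L \<epsilon> n.
        ot_setting X Y \<alpha> \<beta> c L \<longrightarrow> 0 < \<epsilon> \<longrightarrow> 0 < n \<longrightarrow>
        integrable (samples n \<alpha> \<beta>) (sampling_error c \<epsilon> \<alpha> \<beta> n) \<and>
        expected_error c \<epsilon> \<alpha> \<beta> n \<le>
          K (diameter X) (diameter Y) (deriv_norms X Y c) *
          (exp (kappa X Y c L / \<epsilon>) / sqrt (real n) * (1 + 1 / \<epsilon> ^ (CARD('n) div 2)))"
    by (rule exI[of _ "\<lambda>dX dY M. 26 * M ! 0"])
      (intro allI impI conjI ot_setting_error(1) ot_setting_error_kappa; simp)
  show "\<exists>K :: real \<Rightarrow> real \<Rightarrow> real list \<Rightarrow> real.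
      \<forall>dX dY M. \<forall>\<^sub>F \<epsilon> in at_right 0.
        \<forall>(X :: (real^'n) set) Y \<alpha> \<beta> c L n.
          ot_setting X Y \<alpha> \<beta> c L \<longrightarrow>
          diameter X = dX \<longrightarrow> diameter Y = dY \<longrightarrow> deriv_norms X Y c = M \<longrightarrow> 0 < n \<longrightarrow>
          expected_error c \<epsilon> \<alpha> \<beta> n \<le>
            K dX dY M * (exp (kappa X Y c L / \<epsilon>) / (\<epsilon> ^ (CARD('n) div 2) * sqrt (real n)))"
  proof (intro exI[of _ "\<lambda>dX dY M. 26 * M ! 0"] allI)
    fix dX dY :: real and M :: "real list"
    have "\<forall>\<^sub>F \<epsilon> in at_right (0 :: real). \<epsilon> \<in> {0<..<1}"
      by (rule eventually_at_right_real) simp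
    then show "\<forall>\<^sub>F \<epsilon> in at_right 0.
        \<forall>(X :: (real^'n) set) Y \<alpha> \<beta> c L n.
          ot_setting X Y \<alpha> \<beta> c L \<longrightarrow>
          diameter X = dX \<longrightarrow> diameter Y = dY \<longrightarrow> deriv_norms X Y c = M \<longrightarrow> 0 < n \<longrightarrow>
          expected_error c \<epsilon> \<alpha> \<beta> n \<le>
            26 * M ! 0 * (exp (kappa X Y c L / \<epsilon>) / (\<epsilon> ^ (CARD('n) div 2) * sqrt (real n)))"
    proof eventually_elim
      case (elim \<epsilon>)
      then have "0 < \<epsilon>" "1 \<le> 1 / \<epsilon> ^ (CARD('n) div 2)"
        by (simp_all add: power_le_one)
      from ot_setting_error_kappa[OF _ this(1) _ this(2)] show ?case
        by (auto simp: mult.commute)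
    qed
  qed
  show "\<exists>K :: real \<Rightarrow> real \<Rightarrow> real list \<Rightarrow> real.
      \<forall>dX dY M L. \<forall>\<^sub>F \<epsilon> in at_top.
        \<forall>(X :: (real^'n) set) Y \<alpha> \<beta> c n.
          ot_setting X Y \<alpha> \<beta> c L \<longrightarrow>
          diameter X = dX \<longrightarrow> diameter Y = dY \<longrightarrow> deriv_norms X Y c = M \<longrightarrow> 0 < n \<longrightarrow>
          expected_error c \<epsilon> \<alpha> \<beta> n \<le> K dX dY M / sqrt (real n)"
  proof (intro exI[of _ "\<lambda>dX dY M. 26 * M ! 0 * exp 1"] allI)
    fix dX dY L :: real and M :: "real list"
    have "\<forall>\<^sub>F \<epsilon> in at_top. max 1 (2 * (L * dX)) \<le> \<epsilon>"
      by (rule eventually_ge_at_top)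
    then show "\<forall>\<^sub>F \<epsilon> in at_top.
        \<forall>(X :: (real^'n) set) Y \<alpha> \<beta> c n.
          ot_setting X Y \<alpha> \<beta> c L \<longrightarrow>
          diameter X = dX \<longrightarrow> diameter Y = dY \<longrightarrow> deriv_norms X Y c = M \<longrightarrow> 0 < n \<longrightarrow>
          expected_error c \<epsilon> \<alpha> \<beta> n \<le> 26 * M ! 0 * exp 1 / sqrt (real n)"
    proof (eventually_elim, intro allI impI)
      fix \<epsilon> :: real and X Y :: "(real^'n) set" and \<alpha> \<beta> c and n :: nat
      assume large: "max 1 (2 * (L * dX)) \<le> \<epsilon>" and setting: "ot_setting X Y \<alpha> \<beta> c L"
        and eq: "diameter X = dX" "diameter Y = dY" "deriv_norms X Y c = M" and n: "0 < n"
      have \<epsilon>: "0 < \<epsilon>" using large by simp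
      note err = ot_setting_error[OF setting \<epsilon> n]
      have "2 * (L * diameter X) / \<epsilon> \<le> 1"
        using large \<epsilon> eq(1) by simp
      then have "26 * deriv_norm (X \<times> Y) c 0 * exp (2 * (L * diameter X) / \<epsilon>) / sqrt n
          \<le> 26 * deriv_norm (X \<times> Y) c 0 * exp 1 / sqrt n"
        using err(3) by (intro divide_right_mono mult_left_mono) auto
      with err(2) show "expected_error c \<epsilon> \<alpha> \<beta> n \<le> 26 * M ! 0 * exp 1 / sqrt (real n)"
        unfolding eq(3)[symmetric] deriv_norms_nth_0 by linarith
    qed
  qed
qed

end
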